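(* For each fixed odd integer $\Delta\ge 5$, \[ \lim_{n\to\infty}\frac{n^2\bigl(\Delta-\lambda_1(n,\Delta)\bigr)}{\Delta-1}=\frac{\pi^2}{4}. \]
   Context: Graphs are finite, undirected and simple. For a graph $G$, $\rho(G)$ denotes the spectral radius of its adjacency matrix (its largest adjacency eigenvalue). For integers $n\ge 3$ and $2\le\Delta\le n-1$, $\mathcal C(n,\Delta)$ is the family of all connected nonregular graphs of order $n$ (i.e. with $n$ vertices) with maximum degree $\Delta$, and \[ \lambda_1(n,\Delta):=\max_{G\in\mathcal C(n,\Delta)}\rho(G). \] *)

theory Defs
  imports
    "Jordan_Normal_Form.Spectral_Radius"
    "Graph_Theory.Graph_Theory"
begin

(* Finite simple graphs are symmetric loop-free digraphs (locale pair_graph): an edge {u, v} is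
   the pair of arcs (u, v), (v, u), so that the degree of a vertex is its out-degree.
   The vertices of a graph of order n are labelled by 0, ..., n - 1. *)

abbreviation vertex_degree :: "nat pair_pre_digraph \<Rightarrow> nat \<Rightarrow> nat" where
  "vertex_degree G v \<equiv> out_degree (with_proj G) v"

definition max_degree :: "nat pair_pre_digraph \<Rightarrow> nat" where
  "max_degree G = Max (vertex_degree G ` pverts G)"

definition regular_graph :: "nat pair_pre_digraph \<Rightarrow> bool" where
  "regular_graph G \<longleftrightarrow> (\<exists>d. \<forall>v \<in> pverts G. vertex_degree G v = d)"

definition nonregular_family :: "nat \<Rightarrow> nat \<Rightarrow> nat pair_pre_digraph set" where
  "nonregular_family n \<Delta> =
     {G. pair_graph G \<and> pverts G = {..<n} \<and> Digraph_Component.connected (with_proj G)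
         \<and> \<not> regular_graph G \<and> max_degree G = \<Delta>}"

(* Meant for graphs with vertex set {..<n}; the entries are complex because the library's
   spectral_radius is defined for complex matrices. *)
definition adjacency_matrix :: "nat pair_pre_digraph \<Rightarrow> complex mat" where
  "adjacency_matrix G =
     Matrix.mat (card (pverts G)) (card (pverts G)) (\<lambda>(i, j). if (i, j) \<in> parcs G then 1 else 0)"

definition graph_spectral_radius :: "nat pair_pre_digraph \<Rightarrow> real" where
  "graph_spectral_radius G = spectral_radius (adjacency_matrix G)"

(* The family is finite, and nonempty for 2 <= \<Delta> <= n - 1; outside this range Max may be
   applied to the empty set, and the value is then unspecified. *)
definition lambda1 :: "nat \<Rightarrow> nat \<Rightarrow> real" where
  "lambda1 n \<Delta> = Max (graph_spectral_radius ` nonregular_family n \<Delta>)"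

lemma finite_nonregular_family: "finite (nonregular_family n \<Delta>)"
proof (rule finite_subset)
  show "nonregular_family n \<Delta> \<subseteq>
      (\<lambda>A. \<lparr>pverts = {..<n}, parcs = A\<rparr>) ` Pow ({..<n} \<times> {..<n})"
  proof
    fix G assume "G \<in> nonregular_family n \<Delta>"
    then have G: "pair_graph G" "pverts G = {..<n}"
      by (simp_all add: nonregular_family_def)
    interpret pair_graph G by (fact G(1))
    have "parcs G \<subseteq> {..<n} \<times> {..<n}"
      using arc_fst_in_verts arc_snd_in_verts G(2) by force
    moreover have "G = \<lparr>pverts = {..<n}, parcs = parcs G\<rparr>"
      using G(2) by simp
    ultimately show "G \<in> (\<lambda>A. \<lparr>pverts = {..<n}, parcs = A\<rparr>) ` Pow ({..<n} \<times> {..<n})"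
      by blast
  qed
qed simp

end

theory Submission
  imports Defs "HOL-Analysis.Convex" "HOL-Real_Asymp.Real_Asymp"
begin

text \<open>
  Write \<open>a = \<Delta> - 1\<close> and \<open>\<mu> = \<Delta> - \<rho>\<close>.

  Lower bound on \<open>\<mu>\<close>. Let \<open>x\<close> consist of the moduli of an eigenvector for an eigenvalue of modulus
  \<open>\<rho>\<close>, and list the vertices by decreasing \<open>x\<close>, up to the first vertex of degree less than \<open>\<Delta>\<close>. The
  flow \<open>\<Sum>(x s - x t)\<close> along the edges leaving the first \<open>k\<close> vertices is at most \<open>\<mu>\<close> times the sum of
  the first \<open>k\<close> entries. The crucial point is that such a flow lets \<open>x\<close> drop on average by at
  most \<open>flow / a\<close> per vertex. This is clear at positions crossed by at least \<open>a\<close> edges; a position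
  crossed by fewer edges is compensated by the following ones, because \<open>k\<close> vertices of degree
  \<open>a + 1\<close> have at least \<open>k (a + 2 - k)\<close> edges to other vertices. Hence \<open>x\<close> behaves like a solution of
  \<open>a x'' = - \<mu> x\<close> on an interval of length \<open>n\<close> with \<open>x' = 0\<close> at one end and, up to lower order terms,
  \<open>x = 0\<close> at the other; testing against a sine gives \<open>\<mu> \<ge> 4 a sin\<^sup>2 (\<pi> / (4 (n + O(1))))\<close>.

  Upper bound on \<open>\<mu>\<close>. For odd \<open>\<Delta>\<close> copies of the complete graph on \<open>\<Delta> + 1\<close> vertices without an edge
  can be joined by bridges to a chain, closed at one end by a graph on \<open>\<Delta> + 2\<close> vertices that has
  one vertex of degree \<open>\<Delta> - 1\<close>, the end of the first bridge, and otherwise degrees \<open>\<Delta>\<close>. A cosine along the chain is a test vector for the Rayleigh quotient.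
\<close>

subsection \<open>Weights on the gaps of an ordered graph\<close>

definition edges_between :: "(nat \<Rightarrow> nat \<Rightarrow> nat) \<Rightarrow> nat set \<Rightarrow> nat set \<Rightarrow> nat" where
  "edges_between e X Y = (\<Sum>s\<in>X. \<Sum>t\<in>Y. e s t)"

lemma edges_between_mono:
  "X \<subseteq> X' \<Longrightarrow> Y \<subseteq> Y' \<Longrightarrow> finite X' \<Longrightarrow> finite Y' \<Longrightarrow> edges_between e X Y \<le> edges_between e X' Y'"
  unfolding edges_between_def
  by (rule order_trans[OF sum_mono sum_mono2]) (auto intro: sum_mono2)

lemma edges_between_Un_right:
  "finite Y \<Longrightarrow> finite Z \<Longrightarrow> Y \<inter> Z = {} \<Longrightarrow>
   edges_between e X (Y \<union> Z) = edges_between e X Y + edges_between e X Z"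
  by (simp add: edges_between_def sum.union_disjoint sum.distrib)

lemma edges_between_Un_left:
  "finite Y \<Longrightarrow> finite Z \<Longrightarrow> Y \<inter> Z = {} \<Longrightarrow>
   edges_between e (Y \<union> Z) X = edges_between e Y X + edges_between e Z X"
  by (simp add: edges_between_def sum.union_disjoint)

lemma edges_between_le_card:
  assumes "\<And>s t. e s t \<le> 1"
  shows "edges_between e X Y \<le> card X * card Y"
  using sum_bounded_above[of X "\<lambda>s. \<Sum>t\<in>Y. e s t" "card Y"]
    sum_bounded_above[of Y "e _" 1] assms
  by (force simp: edges_between_def)

text \<open>Intended reading: positions list the vertices by decreasing value and \<open>m\<close>
  is the first vertex of degree below \<open>a + 1\<close>. Connectivity enters through
  \<open>cut_pos\<close>.\<close>

locale ordered_graph =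
  fixes e :: "nat \<Rightarrow> nat \<Rightarrow> nat" and n m a :: nat
  assumes e_le: "e s t \<le> 1" and e_sym: "e s t = e t s" and e_irrefl: "e s s = 0"
    and a_pos: "a \<ge> 1" and m_less: "m < n"
    and deg: "s < m \<Longrightarrow> (\<Sum>t<n. e s t) = a + 1"
    and cut_pos: "1 \<le> k \<Longrightarrow> k \<le> m \<Longrightarrow> edges_between e {..<k} {k..<n} \<ge> 1"
begin

text \<open>Gap \<open>i\<close> separates positions \<open>i - 1\<close> and \<open>i\<close>; an
  edge is counted when it spans both gap \<open>i\<close> and gap \<open>k\<close>. In the linear
  program this is the coefficient of the drop at gap \<open>k\<close> in the flow through gap
  \<open>i\<close>.\<close>

definition crossing :: "nat \<Rightarrow> nat \<Rightarrow> nat" where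
  "crossing i k = edges_between e {..<min i k} {max i k..<n}"

abbreviation cut :: "nat \<Rightarrow> nat" where "cut k \<equiv> crossing k k"

section \<open>Edge counts across gaps\<close>

lemma cut_ge_1: "1 \<le> k \<Longrightarrow> k \<le> m \<Longrightarrow> cut k \<ge> 1"
  using cut_pos by (simp add: crossing_def)

lemma edges_between_sym: "edges_between e X Y = edges_between e Y X"
  unfolding edges_between_def by (subst sum.swap) (simp add: e_sym)

lemma edges_between_self:
  assumes "finite X" shows "edges_between e X X \<le> card X * (card X - 1)"
proof -
  have "(\<Sum>t\<in>X. e s t) \<le> card X - 1" if "s \<in> X" for s
  proof -
    have "(\<Sum>t\<in>X. e s t) = (\<Sum>t\<in>X - {s}. e s t)"
      using assms that e_irrefl by (simp add: sum.remove)
    also have "\<dots> \<le> card (X - {s})"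
      using sum_bounded_above[of "X - {s}" "e s" 1] e_le by simp
    finally show ?thesis using that by simp
  qed
  then show ?thesis
    using sum_bounded_above[of X "\<lambda>s. \<Sum>t\<in>X. e s t" "card X - 1"] by (simp add: edges_between_def)
qed

text \<open>Split the degree sum of \<open>k\<close> consecutive vertices: edges to the left (at
  most \<open>cut p\<close>), edges inside (counted twice, so at most \<open>k * (k - 1)\<close>),
  and edges to the right.\<close>

lemma degree_sum_le:
  assumes "p + k \<le> m"
  shows "k * (a + 1) \<le> cut p + k * (k - 1) + edges_between e {p..<p+k} {p+k..<n}"
proof -
  let ?T = "{p..<p+k}"
  have "k * (a + 1) = edges_between e ?T {..<n}"
    using deg assms by (simp add: edges_between_def)
  also have "{..<n} = {..<p} \<union> (?T \<union> {p+k..<n})" using assms m_less by auto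
  also have "edges_between e ?T \<dots> = edges_between e ?T {..<p} + (edges_between e ?T ?T + edges_between e ?T {p+k..<n})"
    by (subst edges_between_Un_right, auto)+
  also have "edges_between e ?T {..<p} \<le> cut p"
    unfolding crossing_def using assms m_less
    by (subst edges_between_sym) (intro edges_between_mono, auto)
  also have "edges_between e ?T ?T \<le> k * (k - 1)" using edges_between_self[of ?T] by simp
  finally show ?thesis by simp
qed

lemma cut_lower_bound:
  assumes "p + k \<le> m"
  shows "k * (a + 1) \<le> cut p + k * (k - 1) + cut (p + k)"
proof -
  have "edges_between e {p..<p+k} {p+k..<n} \<le> cut (p + k)"
    unfolding crossing_def by (intro edges_between_mono) auto
  with degree_sum_le[OF assms] show ?thesis by simp
qed

text \<open>Refines the degree count. Among the edges going right from the \<open>k\<close>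
  vertices, only those from \<open>{p+1..<p+k}\<close> to \<open>{p+k..<q}\<close> avoid both gap
  \<open>p + 1\<close> and gap \<open>q\<close>; their number is bounded by the product of the two
  sizes.\<close>

lemma crossing_lower_bound:
  assumes "q \<le> m" "1 \<le> k" "p + k < q"
  shows "k * (a + 1) \<le> cut p + k * (k - 1) + (k - 1) * (q - (p + k))
      + crossing (p + 1) (p + k) + crossing q (p + k)"
proof -
  let ?Y = "{p+k..<q}" and ?Z = "{q..<n}"
  have Z: "{p+k..<n} = ?Y \<union> ?Z" and T: "{p..<p+k} = {p} \<union> {p+1..<p+k}" using assms m_less by auto
  have "edges_between e {p..<p+k} {p+k..<n} = edges_between e {p..<p+k} ?Y + edges_between e {p..<p+k} ?Z"
    unfolding Z by (rule edges_between_Un_right) auto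
  also have "edges_between e {p..<p+k} ?Y = edges_between e {p} ?Y + edges_between e {p+1..<p+k} ?Y"
    unfolding T by (rule edges_between_Un_left) auto
  also have "edges_between e {p} ?Y \<le> crossing (p + 1) (p + k)"
    unfolding crossing_def using assms m_less by (intro edges_between_mono) auto
  also have "edges_between e {p+1..<p+k} ?Y \<le> (k - 1) * (q - (p + k))"
    using edges_between_le_card[of e "{p+1..<p+k}" ?Y] e_le by simp
  also have "edges_between e {p..<p+k} ?Z \<le> crossing q (p + k)"
    unfolding crossing_def using assms m_less by (intro edges_between_mono) auto
  finally show ?thesis using degree_sum_le[of p k] assms by simp
qed

text \<open>
  An admissible weight \<^term>\<open>y\<close> on the gaps from \<^term>\<open>p\<close> on is a feasible point of the linear program dual to
  maximising a decrease of values subject to unit flow across every gap: the edges crossing a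
  gap have total length at least 1. Only weights at most \<^term>\<open>a + 2\<close> positions before a gap count
  for it, so that slowly varying factors can be pulled in, and the last clause says that
  \<^term>\<open>y\<close> has density at most \<^term>\<open>1 / a\<close>, up to a bounded contribution at the end.
\<close>

definition admissible :: "nat \<Rightarrow> (nat \<Rightarrow> real) \<Rightarrow> bool" where
  "admissible p (y::nat \<Rightarrow> real) \<longleftrightarrow> (\<forall>i. 0 \<le> y i) \<and> (p \<le> m \<longrightarrow> 1 / a \<le> y p) \<and>
     (\<forall>k\<in>{p..m}. 1 \<le> (\<Sum>i\<in>{max p (k - (a + 2))..m}. y i * real (crossing i k))) \<and>
     (\<forall>W::nat \<Rightarrow> real. mono W \<longrightarrow> (\<forall>i. 0 \<le> W i) \<longrightarrow>
        (\<Sum>i=p..m. y i * W i) \<le> (\<Sum>i=p..m. W (i + (a + 2))) / a + (a + 2) * W m)"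

text \<open>Weights are built from the right by prepending blocks. A block has length at most
  \<open>a + 2\<close>, so the window of each of its gaps reaches back to \<open>p\<close>. Moving
  the mass of the block to its right end moves it by less than \<open>a + 2\<close>, which the shift
  in the argument of \<open>W\<close> pays for. Gap \<open>q\<close> may help the block because its
  weight is at least \<open>1 / a\<close>.\<close>

lemma admissible_extend:
  assumes y: "admissible q y" and pq: "p < q" "q \<le> m" "q \<le> p + a + 2"
    and z: "\<And>i. 0 \<le> z i" "1 / a \<le> z p" "(\<Sum>i=p..<q. z i) \<le> (q - p) / a"
    and cov: "\<And>k. p \<le> k \<Longrightarrow> k < q \<Longrightarrow> 1 \<le> (\<Sum>i=p..<q. z i * real (crossing i k)) + crossing q k / a"
  shows "admissible p (\<lambda>i. if i < q then z i else y i)"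
proof -
  let ?y = "\<lambda>i. if i < q then z i else y i"
  have y0: "\<And>i. 0 \<le> y i" and yq: "1 / a \<le> y q" 
    and ycov: "\<And>k. q \<le> k \<Longrightarrow> k \<le> m \<Longrightarrow> 1 \<le> (\<Sum>i\<in>{max q (k - (a + 2))..m}. y i * real (crossing i k))"
    and yW: "\<And>W::nat \<Rightarrow> real. mono W \<Longrightarrow> (\<forall>i. 0 \<le> W i) \<Longrightarrow>
        (\<Sum>i=q..m. y i * W i) \<le> (\<Sum>i=q..m. W (i + (a + 2))) / a + (a + 2) * W m"
    using y pq unfolding admissible_def by auto
  have "1 \<le> (\<Sum>i\<in>{max p (k - (a + 2))..m}. ?y i * real (crossing i k))" if k: "p \<le> k" "k \<le> m" for k
  proof (cases "k < q")
    case True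
    have "1 \<le> (\<Sum>i=p..<q. z i * real (crossing i k)) + crossing q k / a" using cov k True by simp
    also have "crossing q k / a \<le> y q * crossing q k"
      using mult_right_mono[OF yq, of "crossing q k"] by simp
    also have "(\<Sum>i=p..<q. z i * real (crossing i k)) + y q * crossing q k
        = (\<Sum>i\<in>{p..<q} \<union> {q}. ?y i * real (crossing i k))"
      by (subst sum.union_disjoint) auto
    also have "\<dots> \<le> (\<Sum>i\<in>{max p (k - (a + 2))..m}. ?y i * real (crossing i k))"
      using pq k True z y0 by (intro sum_mono2) auto
    finally show ?thesis by simp
  next
    case False
    have "1 \<le> (\<Sum>i\<in>{max q (k - (a + 2))..m}. y i * real (crossing i k))" using ycov k False by simp
    also have "\<dots> = (\<Sum>i\<in>{max q (k - (a + 2))..m}. ?y i * real (crossing i k))"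
      by (intro sum.cong) auto
    also have "\<dots> \<le> (\<Sum>i\<in>{max p (k - (a + 2))..m}. ?y i * real (crossing i k))"
      using pq z y0 by (intro sum_mono2) auto
    finally show ?thesis .
  qed
  moreover have "(\<Sum>i=p..m. ?y i * W i) \<le> (\<Sum>i=p..m. W (i + (a + 2))) / a + (a + 2) * W m"
    if W: "mono W" "\<forall>i. 0 \<le> W i" for W :: "nat \<Rightarrow> real"
  proof -
    have split: "{p..m} = {p..<q} \<union> {q..m}" using pq by auto
    have "(\<Sum>i=p..<q. z i * W i) \<le> (\<Sum>i=p..<q. z i * W (q - 1))"
      using z W by (intro sum_mono mult_left_mono) (auto intro!: monoD[OF W(1)])
    also have "\<dots> \<le> (q - p) / a * W (q - 1)"
      unfolding sum_distrib_right[symmetric] using z(3) W pq by (intro mult_right_mono) auto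
    also have "\<dots> = (\<Sum>i=p..<q. W (q - 1)) / a" using pq by simp
    also have "\<dots> \<le> (\<Sum>i=p..<q. W (i + (a + 2))) / a"
      using pq by (intro divide_right_mono sum_mono) (auto intro!: monoD[OF W(1)])
    finally have 1: "(\<Sum>i=p..<q. z i * W i) \<le> (\<Sum>i=p..<q. W (i + (a + 2))) / a" .
    have "(\<Sum>i=p..m. ?y i * W i) = (\<Sum>i=p..<q. z i * W i) + (\<Sum>i=q..m. y i * W i)"
      unfolding split by (subst sum.union_disjoint) auto
    moreover have "(\<Sum>i=p..m. W (i + (a + 2))) = (\<Sum>i=p..<q. W (i + (a + 2))) + (\<Sum>i=q..m. W (i + (a + 2)))"
      unfolding split by (subst sum.union_disjoint) auto
    ultimately show ?thesis using 1 yW[OF W] by (simp add: add_divide_distrib)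
  qed
  ultimately show ?thesis using y0 z pq by (auto simp: admissible_def)
qed

text \<open>Makes the weights on the first two gaps of a block fit the density \<open>1 / a\<close>
  on a block of length \<open>a + 2 - c\<close>. For \<open>c = 1\<close> there is equality;
  otherwise the claim reduces to \<open>(c - 2) * (a - c)\<close> being nonnegative.\<close>

lemma budget:
  assumes c: "1 \<le> c" "c < a" and d: "c \<le> d" "d \<le> a" "c = 1 \<Longrightarrow> d = a"
  shows "1 / real c + 1 / real d \<le> (real a + 2 - real c) / real a"
proof (cases "c = 1")
  case True
  then show ?thesis using d c by (simp add: field_simps)
next
  case False
  have "0 \<le> (real c - 2) * (real a - real c)" using False c by simp
  then have "2 / real c \<le> (real a + 2 - real c) / real a"
    using c by (simp add: field_simps)
  moreover have "1 / real d \<le> 1 / real c" using c d by (simp add: frac_le)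
  ultimately show ?thesis by simp
qed

text \<open>
  A narrow gap, of cut \<open>c < a\<close>, is paid for by leaving the gaps \<open>p + 2, \<dots>, q - 1\<close> without weight: an
  edge across one of these that avoids gap \<open>p + 1\<close> and gap \<^term>\<open>q\<close> runs between few vertices.
\<close>

lemma block_cover:
  assumes c: "cut p < a" "cut p \<le> cut (p + 1)" "cut p \<ge> 1"
    and q: "q = p + a + 2 - cut p" "q \<le> m"
    and k: "p \<le> k" "k < q"
    and z: "z p = 1 / real (cut p)" "z (p + 1) = 1 / real (min (cut (p + 1)) a)" "\<And>i. (0::real) \<le> z i"
  shows "1 \<le> (\<Sum>i\<in>{p, p + 1}. z i * real (crossing i k)) + crossing q k / a"
proof -
  have sum: "(\<Sum>i\<in>{p, p + 1}. z i * real (crossing i k)) = z p * crossing p k + z (p+1) * crossing (p+1) k"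
    by simp
  consider "k = p" | "k = p + 1" | j where "k = p + j" "2 \<le> j"
    using k that(3)[of "k - p"] by linarith
  then show ?thesis
  proof cases
    case 1
    then have "z p * crossing p k = 1" using z c by simp
    moreover have "0 \<le> z (p+1) * crossing (p+1) k" using z(3) by simp
    ultimately show ?thesis unfolding sum by simp
  next
    case 2
    have "1 \<le> z (p+1) * crossing (p+1) k" 
      using c a_pos unfolding 2 z(2) by (auto simp: field_simps min_def)
    moreover have "0 \<le> z p * crossing p k" "0 \<le> crossing q k / a" using z(3) by simp_all
    ultimately show ?thesis unfolding sum by linarith
  next
    case 3
    define r where "r = q - (p + j)"
    define i where "i = j - 2"
    define b where "b = cut p - 1"
    have r: "q = p + j + r" using k 3 by (simp add: r_def)
    have ar: "a + 2 = cut p + j + r" using q r c by linarith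
    have i: "j = i + 2" using 3(2) by (simp add: i_def)
    have b: "cut p = b + 1" using c(3) by (simp add: b_def)
    have "j * (a + 1) \<le> cut p + j * (j - 1) + (j - 1) * r + crossing (p + 1) (p + j) + crossing q (p + j)"
      unfolding r_def using q(2) 3 k by (intro crossing_lower_bound) auto
    \<comment> \<open>With \<open>a + 2 = cut p + j + r\<close>, the degree count leaves exactly
      \<open>a + (j - 2) * (cut p - 1)\<close> edges that must cross gap \<open>p + 1\<close> or gap
      \<open>q\<close>, hence at least \<open>a\<close>.\<close>
    moreover have "cut p + j * (j - 1) + (j - 1) * r + a + i * b = j * (a + 1)"
    proof -
      have "a = b + 1 + i + r" using ar i b by linarith
      then show ?thesis unfolding i b by (simp add: algebra_simps)
    qed
    ultimately have le: "a \<le> crossing (p + 1) k + crossing q k"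
      unfolding 3(1) by linarith
    have "1 / real a \<le> z (p + 1)" unfolding z(2) using a_pos c by (simp add: frac_le)
    then have "crossing (p+1) k / a \<le> z (p + 1) * crossing (p + 1) k"
      using mult_right_mono[of "1 / real a" "z (p + 1)" "crossing (p+1) k"] by simp
    moreover have "1 \<le> (crossing (p + 1) k + crossing q k) / a"
      using le a_pos by (simp add: field_simps)
    moreover have "0 \<le> z p * crossing p k" using z(3) by simp
    ultimately show ?thesis unfolding sum by (simp add: add_divide_distrib)
  qed
qed

text \<open>The length \<open>a + 2 - cut p\<close> is large enough for \<open>budget\<close> to pay
  for gaps \<open>p\<close> and \<open>p + 1\<close>, and small enough for
  \<open>block_cover\<close> to leave the other gaps of the block empty.\<close>

lemma admissible_block:
  assumes p: "1 \<le> p" and c: "cut p < a" "cut p \<le> cut (p + 1)"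
    and q: "q = p + a + 2 - cut p" "q \<le> m" and y: "admissible q y"
  obtains y' where "admissible p y'"
proof -
  have c1: "cut p \<ge> 1" using cut_ge_1 p q c by simp
  define z where "z i = (if i = p then 1 / real (cut p) 
    else if i = p + 1 then 1 / real (min (cut (p + 1)) a) else 0)" for i
  have z0: "0 \<le> z i" for i by (simp add: z_def)
  have sub: "{p, p + 1} \<subseteq> {p..<q}" using q c by auto
  have sum: "(\<Sum>i=p..<q. z i * g i) = (\<Sum>i\<in>{p, p + 1}. z i * g i)" for g
    using sub by (intro sum.mono_neutral_right) (auto simp: z_def)
  have "admissible p (\<lambda>i. if i < q then z i else y i)"
  proof (rule admissible_extend[OF y])
    show "p < q" "q \<le> m" "q \<le> p + a + 2" using q c by auto
    show "1 / real a \<le> z p" using c c1 by (simp add: z_def frac_le)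
    have "p + 1 \<le> m" using q c by simp
    \<comment> \<open>The vertex at position \<open>p\<close> has degree \<open>a + 1\<close>, so if
      one edge crosses gap \<open>p\<close>, at least \<open>a\<close> edges cross the next gap: the
      side condition of \<open>budget\<close>.\<close>
    then have "cut p = 1 \<Longrightarrow> cut (p + 1) \<ge> a" using cut_lower_bound[of p 1] by simp
    then have "1 / real (cut p) + 1 / real (min (cut (p + 1)) a) \<le> (real a + 2 - real (cut p)) / real a"
      using c c1 by (intro budget) auto
    also have "real a + 2 - real (cut p) = real (q - p)" using q c by simp
    finally show "(\<Sum>i=p..<q. z i) \<le> (real q - real p) / real a"
      using sum[of "\<lambda>_. 1"] \<open>p < q\<close> by (simp add: z_def of_nat_diff)
    show "1 \<le> (\<Sum>i=p..<q. z i * real (crossing i k)) + crossing q k / a" if "p \<le> k" "k < q" for k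
      unfolding sum by (rule block_cover) (use that c c1 q z0 in \<open>auto simp: z_def\<close>)
  qed (use z0 in auto)
  then show ?thesis by (rule that)
qed

text \<open>If the cut decreases after \<open>p\<close>, the block starts at \<open>p + 1\<close>
  instead, and gap \<open>p\<close> gets its own weight \<open>1 / cut p\<close>. Two vertices of
  degree \<open>a + 1\<close> and \<open>cut p < a\<close> force at least \<open>a\<close> edges
  across gap \<open>p + 2\<close>, so \<open>1 / a\<close> suffices there; this third weight is paid
  for by the additional position.\<close>

lemma admissible_late_block:
  assumes p: "1 \<le> p" and c: "cut p < a" "cut (p + 1) < cut p"
    and q: "q = p + 1 + a + 2 - cut (p + 1)" "q \<le> m" and y: "admissible q y"
  obtains y' where "admissible p y'"
proof -
  have c1: "cut (p + 1) \<ge> 1" using cut_ge_1 p q c by simp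
  have pm: "p + 2 \<le> m" using q c by linarith
  have sum1: "a + 1 \<le> cut p + cut (p + 1)" using cut_lower_bound[of p 1] pm by simp
  have "2 * a \<le> cut p + cut (p + 2)" using cut_lower_bound[of p 2] pm by simp
  then have c2: "a \<le> cut (p + 2)" using c by linarith
  define z where "z i = (if i = p then 1 / real (cut p) 
    else if i = p + 1 then 1 / real (cut (p + 1)) else if i = p + 2 then 1 / real a else 0)" for i
  have z0: "0 \<le> z i" for i by (simp add: z_def)
  have sub: "{p, p + 1, p + 2} \<subseteq> {p..<q}" using q c by auto
  have sum: "(\<Sum>i=p..<q. z i * g i) = z p * g p + (\<Sum>i\<in>{p + 1, p + 2}. z i * g i)" for g
  proof -
    have "(\<Sum>i=p..<q. z i * g i) = (\<Sum>i\<in>{p, p + 1, p + 2}. z i * g i)"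
      using sub by (intro sum.mono_neutral_right) (auto simp: z_def)
    then show ?thesis by simp
  qed
  have "admissible p (\<lambda>i. if i < q then z i else y i)"
  proof (rule admissible_extend[OF y])
    show "p < q" "q \<le> m" "q \<le> p + a + 2" using q c sum1 by auto
    show "1 / real a \<le> z p" using c c1 by (simp add: z_def frac_le)
    have "1 / real (cut (p + 1)) + 1 / real (cut p) \<le> (real a + 2 - real (cut (p + 1))) / real a"
      using c c1 sum1 by (intro budget) auto
    then have "1 / real (cut p) + (1 / real (cut (p + 1)) + 1 / real a) \<le> (1 + (real a + 2 - real (cut (p + 1)))) / real a"
      by (simp add: add_divide_distrib diff_divide_distrib)
    also have "1 + (real a + 2 - real (cut (p + 1))) = real (q - p)" using q c by simp
    finally show "(\<Sum>i=p..<q. z i) \<le> (real q - real p) / real a"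
      using sum[of "\<lambda>_. 1"] \<open>p < q\<close> by (simp add: z_def of_nat_diff)
    show "1 \<le> (\<Sum>i=p..<q. z i * real (crossing i k)) + crossing q k / a" if k: "p \<le> k" "k < q" for k
    proof (cases "k = p")
      case True
      have "z p * crossing p k = 1" using True c c1 by (simp add: z_def)
      moreover have "0 \<le> (\<Sum>i\<in>{p + 1, p + 2}. z i * real (crossing i k))" using z0 by (intro sum_nonneg) simp
      moreover have "0 \<le> real (crossing q k) / a" by simp
      ultimately show ?thesis unfolding sum by linarith
    next
      case False
      have "1 \<le> (\<Sum>i\<in>{p + 1, p + 1 + 1}. z i * real (crossing i k)) + crossing q k / a"
        by (rule block_cover) (use k False c c1 c2 q z0 in \<open>auto simp: z_def numeral_2_eq_2\<close>)
      moreover have "0 \<le> z p * crossing p k" using z0 by simp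
      ultimately show ?thesis unfolding sum by simp
    qed
  qed (use z0 in auto)
  then show ?thesis by (rule that)
qed

lemma admissible_single:
  assumes p: "p < m" and c: "a \<le> cut p" and y: "admissible (p + 1) y"
  obtains y' where "admissible p y'"
proof -
  have "admissible p (\<lambda>i. if i < p + 1 then 1 / a else y i)"
  proof (rule admissible_extend[OF y])
    show "1 \<le> (\<Sum>i=p..<p+1. 1 / real a * crossing i k) + crossing (p + 1) k / a"
      if "p \<le> k" "k < p + 1" for k
    proof -
      have "k = p" using that by simp
      moreover have "1 \<le> real (cut p) / a" using c a_pos by simp
      moreover have "0 \<le> crossing (p + 1) k / a" by simp
      moreover have "(\<Sum>i=p..<p+1. 1 / real a * real (crossing i k)) = real (cut p) / a"
        using \<open>k = p\<close> by simp
      ultimately show ?thesis by linarith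
    qed
  qed (use p in auto)
  then show ?thesis by (rule that)
qed

text \<open>Base of the construction: on the last few gaps weight 1 works because every cut is
  nonempty. This is the source of the error term \<open>(a + 2) * W m\<close>.\<close>

lemma admissible_end:
  assumes "1 \<le> p" "m < p + a + 2"
  shows "admissible p (\<lambda>_. 1)"
proof -
  have "1 \<le> (\<Sum>i\<in>{max p (k - (a + 2))..m}. 1 * real (crossing i k))" if k: "k \<in> {p..m}" for k
  proof -
    have "1 \<le> (\<Sum>i\<in>{k}. 1 * real (crossing i k))" using cut_ge_1[of k] assms k by simp
    also have "\<dots> \<le> (\<Sum>i\<in>{max p (k - (a + 2))..m}. 1 * real (crossing i k))"
      using k by (intro sum_mono2) auto
    finally show ?thesis .
  qed
  moreover have "(\<Sum>i=p..m. 1 * W i) \<le> (\<Sum>i=p..m. W (i + (a + 2))) / a + (a + 2) * W m"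
    if W: "mono W" "\<forall>i. 0 \<le> W i" for W :: "nat \<Rightarrow> real"
  proof -
    have "(\<Sum>i=p..m. W i) \<le> of_nat (card {p..m}) * W m"
      by (rule sum_bounded_above) (auto intro: monoD[OF W(1)])
    also have "\<dots> \<le> (a + 2) * W m" using W assms by (intro mult_right_mono) auto
    moreover have "0 \<le> (\<Sum>i=p..m. W (i + (a + 2))) / a" using W by (simp add: sum_nonneg)
    ultimately show ?thesis by simp
  qed
  ultimately show ?thesis using a_pos by (auto simp: admissible_def)
qed

text \<open>Induction on the distance to \<open>m\<close>. A gap with at least \<open>a\<close>
  edges is a block by itself; at a narrower gap the next cut decides between the two kinds of
  block.\<close>

lemma admissible_exists:
  assumes "1 \<le> p" shows "\<exists>y. admissible p y"
  using assms
proof (induction "m - p" arbitrary: p rule: less_induct)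
  case less
  show ?case
  proof (cases "m < p + a + 2")
    case True
    then show ?thesis using admissible_end less.prems by blast
  next
    case pm: False
    consider "a \<le> cut p" | "cut p < a" "cut p \<le> cut (p + 1)" | "cut p < a" "cut (p + 1) < cut p"
      by linarith
    then show ?thesis
    proof cases
      case 1
      then show ?thesis using less.hyps[of "p + 1"] pm admissible_single[of p] by fastforce
    next
      case 2
      let ?q = "p + a + 2 - cut p"
      have "p < ?q" "?q \<le> m" using pm 2 by auto
      then show ?thesis using less.hyps[of ?q] admissible_block[of p ?q] 2 less.prems by fastforce
    next
      case 3
      let ?q = "p + 1 + a + 2 - cut (p + 1)"
      have "1 \<le> cut (p + 1)" using cut_ge_1 pm by simp
      then have "p < ?q" "?q \<le> m" using pm 3 by auto
      then show ?thesis using less.hyps[of ?q] admissible_late_block[of p ?q] 3 less.prems by fastforce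
    qed
  qed
qed


section \<open>Admissible weights against the drops of a decreasing sequence\<close>

lemma crossing_eq_sum:
  assumes "i \<le> n"
  shows "real (crossing i k) = (\<Sum>s<i. \<Sum>t=i..<n. real (e s t) * of_bool (s < k \<and> k \<le> t))"
proof -
  have *: "(\<Sum>t=max i k..<n. real (e s t)) = (\<Sum>t=i..<n. real (e s t) * of_bool (k \<le> t))" for s
    by (rule sum.mono_neutral_cong_left) auto
  have "real (crossing i k) = (\<Sum>s<min i k. \<Sum>t=max i k..<n. real (e s t))"
    by (simp add: crossing_def edges_between_def)
  also have "\<dots> = (\<Sum>s<i. \<Sum>t=i..<n. real (e s t) * of_bool (s < k \<and> k \<le> t))"
    unfolding * by (rule sum.mono_neutral_cong_left) (auto simp del: sum_mult_of_bool_eq intro!: sum.neutral)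
  finally show ?thesis .
qed

text \<open>The drop along an edge telescopes into the drops at the gaps it spans. Gaps beyond
  \<open>m\<close> are discarded, which only decreases the sum as \<open>x\<close> is
  decreasing.\<close>

lemma flux_lower_bound:
  fixes x :: "nat \<Rightarrow> real"
  assumes x: "\<And>s t. s \<le> t \<Longrightarrow> t < n \<Longrightarrow> x t \<le> x s" and i: "i \<le> m"
  shows "(\<Sum>k=1..m. crossing i k * (x (k - 1) - x k)) \<le> (\<Sum>s<i. \<Sum>t=i..<n. e s t * (x s - x t))"
proof -
  have "(\<Sum>k=1..m. crossing i k * (x (k - 1) - x k))
      = (\<Sum>k=1..m. \<Sum>s<i. \<Sum>t=i..<n. e s t * (of_bool (s < k \<and> k \<le> t) * (x (k - 1) - x k)))"
    using i m_less by (simp add: crossing_eq_sum sum_distrib_right mult.assoc del: sum_mult_of_bool_eq)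
  also have "\<dots> = (\<Sum>s<i. \<Sum>t=i..<n. e s t * (\<Sum>k=1..m. of_bool (s < k \<and> k \<le> t) * (x (k - 1) - x k)))"
    by (subst sum.swap, rule sum.cong[OF refl], subst sum.swap)
       (simp add: sum_distrib_left del: sum_of_bool_mult_eq sum_mult_of_bool_eq)
  also have "\<dots> \<le> (\<Sum>s<i. \<Sum>t=i..<n. e s t * (x s - x t))"
  proof (intro sum_mono mult_left_mono)
    fix s t assume s: "s \<in> {..<i}" and t: "t \<in> {i..<n}"
    have "(\<Sum>k=1..m. of_bool (s < k \<and> k \<le> t) * (x (k - 1) - x k)) = (\<Sum>k=Suc s..min t m. x (k - 1) - x k)"
      by (rule sum.mono_neutral_cong_right) auto
    also have "\<dots> = x s - x (min t m)"
    proof -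
      have "(\<Sum>k=Suc s..u. x (k - 1) - x k) = x s - x u" if "s \<le> u" for u
        using that by (induction u rule: dec_induct) auto
      then show ?thesis using s t i by simp
    qed
    also have "\<dots> \<le> x s - x t" using x[of "min t m" t] t by simp
    finally show "(\<Sum>k=1..m. of_bool (s < k \<and> k \<le> t) * (x (k - 1) - x k)) \<le> x s - x t" .
  qed simp
  finally show ?thesis .
qed

text \<open>Weak duality. Coverage bounds 1 by the weights at positions \<open>i\<close> with
  \<open>k - (a + 2) \<le> i\<close>, so \<open>\<omega> k\<close> is at most
  \<open>\<omega> (i + (a + 2))\<close>. After exchanging the sums the flux bound applies, and the
  density clause for \<open>W i = \<omega> (i + (a + 2)) * F i\<close> contributes the second
  shift.\<close>

lemma weighted_gap_bound:
  fixes x F \<omega> :: "nat \<Rightarrow> real"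
  assumes x: "\<And>s t. s \<le> t \<Longrightarrow> t < n \<Longrightarrow> x t \<le> x s"
    and flux: "\<And>i. 1 \<le> i \<Longrightarrow> i \<le> m \<Longrightarrow> (\<Sum>s<i. \<Sum>t=i..<n. e s t * (x s - x t)) \<le> F i"
    and F: "mono F" "\<And>i. 0 \<le> F i" and \<omega>: "mono \<omega>" "\<And>i. 0 \<le> \<omega> i"
  shows "(\<Sum>k=1..m. (x (k - 1) - x k) * \<omega> k)
    \<le> (\<Sum>i=1..m. \<omega> (i + 2 * (a + 2)) * F (i + (a + 2))) / a + (a + 2) * \<omega> (m + (a + 2)) * F m"
proof -
  obtain y where y: "admissible 1 y" using admissible_exists by blast
  have y0: "0 \<le> y i" for i using y by (simp add: admissible_def)
  let ?\<delta> = "\<lambda>k. x (k - 1) - x k"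
  have \<delta>0: "0 \<le> ?\<delta> k" if "k \<le> m" for k using x[of "k - 1" k] that m_less by simp
  have "(\<Sum>k=1..m. ?\<delta> k * \<omega> k) \<le> (\<Sum>k=1..m. ?\<delta> k * (\<Sum>i=1..m. y i * \<omega> (i + (a + 2)) * crossing i k))"
  proof (intro sum_mono mult_left_mono)
    fix k assume k: "k \<in> {1..m}"
    let ?I = "{max 1 (k - (a + 2))..m}"
    have "\<omega> k \<le> \<omega> k * (\<Sum>i\<in>?I. y i * crossing i k)"
      using y k mult_left_mono[OF _ \<omega>(2), of 1 _ k] by (auto simp: admissible_def)
    also have "\<dots> = (\<Sum>i\<in>?I. y i * \<omega> k * crossing i k)" by (simp add: sum_distrib_left mult_ac)
    also have "\<dots> \<le> (\<Sum>i\<in>?I. y i * \<omega> (i + (a + 2)) * crossing i k)"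
      using y0 by (intro sum_mono mult_right_mono mult_left_mono monoD[OF \<omega>(1)]) auto
    also have "\<dots> \<le> (\<Sum>i=1..m. y i * \<omega> (i + (a + 2)) * crossing i k)"
      using y0 \<omega> by (intro sum_mono2) auto
    finally show "\<omega> k \<le> (\<Sum>i=1..m. y i * \<omega> (i + (a + 2)) * crossing i k)" .
  qed (use \<delta>0 in auto)
  also have "\<dots> = (\<Sum>i=1..m. y i * \<omega> (i + (a + 2)) * (\<Sum>k=1..m. crossing i k * ?\<delta> k))"
    unfolding sum_distrib_left by (subst sum.swap) (simp add: mult_ac)
  also have "\<dots> \<le> (\<Sum>i=1..m. y i * \<omega> (i + (a + 2)) * F i)"
    using y0 \<omega> by (intro sum_mono mult_left_mono order_trans[OF flux_lower_bound flux] x) auto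
  also have "\<dots> = (\<Sum>i=1..m. y i * (\<omega> (i + (a + 2)) * F i))" by (simp add: mult_ac)
  also have "\<dots> \<le> (\<Sum>i=1..m. \<omega> (i + (a + 2) + (a + 2)) * F (i + (a + 2))) / a + (a + 2) * (\<omega> (m + (a + 2)) * F m)"
  proof -
    let ?W = "\<lambda>i. \<omega> (i + (a + 2)) * F i"
    have "mono ?W" using F \<omega> by (intro monoI mult_mono) (auto intro!: monoD[OF F(1)] monoD[OF \<omega>(1)])
    moreover have "\<forall>i. 0 \<le> ?W i" using F \<omega> by simp
    ultimately show ?thesis using y unfolding admissible_def by blast
  qed
  finally show ?thesis by (simp add: mult_ac mult_2 mult_2_right add.assoc)
qed

end

subsection \<open>Comparison with the sine\<close>

text \<open>A crude Jordan inequality; the factor 4 is compensated by the summand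
  \<open>4 * C\<close> in \<open>N\<close> below.\<close>

lemma sin_ge_quarter:
  fixes u :: real
  assumes "0 \<le> u" "u \<le> pi / 2" shows "u / 4 \<le> sin u"
proof (cases "u \<le> pi / 3")
  case True
  show ?thesis
  proof (cases "u = 0")
    case False
    obtain \<xi> where \<xi>: "0 < \<xi>" "\<xi> < u" "sin u - sin 0 = (u - 0) * cos \<xi>"
      using MVT2[of 0 u sin cos] assms False by auto
    have "1 / 2 \<le> cos \<xi>"
      using cos_monotone_0_pi_le[of \<xi> "pi/3"] \<xi> True by (simp add: cos_60)
    then have "u * (1 / 2) \<le> u * cos \<xi>" using assms by (intro mult_left_mono)
    then show ?thesis using \<xi> assms by simp
  qed simp
next
  case False
  have "sin (pi / 6) \<le> sin u"
    using False assms pi_gt_zero by (intro sin_monotone_2pi_le) linarith+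
  then show ?thesis using assms pi_less_4 by (simp add: sin_30)
qed

lemma sum_sin_arith:
  assumes "j \<le> m"
  shows "2 * sin (\<theta> / 2) * (\<Sum>l=Suc j..m. sin (real l * \<theta>))
    = cos ((real j + 1 / 2) * \<theta>) - cos ((real m + 1 / 2) * \<theta>)"
  using assms
proof (induction m rule: dec_induct)
  case (step m)
  have "2 * sin (\<theta> / 2) * sin (real (Suc m) * \<theta>)
      = cos ((real m + 1 / 2) * \<theta>) - cos ((real (Suc m) + 1 / 2) * \<theta>)"
  proof -
    have "\<theta> / 2 - real (Suc m) * \<theta> = - ((real m + 1 / 2) * \<theta>)"
      "\<theta> / 2 + real (Suc m) * \<theta> = (real (Suc m) + 1 / 2) * \<theta>"
      by (simp_all add: field_simps)
    then show ?thesis by (simp only: mult.assoc sin_times_sin cos_minus) simp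
  qed
  with step show ?case by (simp add: distrib_left)
qed simp

lemma sin_diff_arith:
  "sin (real (Suc j) * \<theta>) - sin (real j * \<theta>) = 2 * sin (\<theta> / 2) * cos ((real j + 1 / 2) * \<theta>)"
  by (subst sin_diff_sin) (simp add: algebra_simps add_divide_distrib)

lemma sum_by_parts:
  fixes x w :: "nat \<Rightarrow> real"
  assumes "w 0 = 0"
  shows "(\<Sum>k=1..m. (x (k - 1) - x k) * w k) + x m * w (Suc m) = (\<Sum>j\<le>m. x j * (w (Suc j) - w j))"
proof (induction m)
  case 0
  then show ?case using assms by simp
next
  case (Suc m)
  have "(\<Sum>k=1..Suc m. (x (k - 1) - x k) * w k) + x (Suc m) * w (Suc (Suc m))
      = ((\<Sum>k=1..m. (x (k - 1) - x k) * w k) + x m * w (Suc m)) + x (Suc m) * (w (Suc (Suc m)) - w (Suc m))"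
    by (simp add: left_diff_distrib right_diff_distrib)
  then show ?case unfolding Suc by simp
qed

text \<open>After the shift the indices lie above \<open>j\<close> and exceed \<open>m\<close> by at
  most \<open>2 * L\<close>; each of these excess terms is at most 1.\<close>

lemma shifted_sum_le:
  fixes w :: "nat \<Rightarrow> real"
  assumes "\<And>i. 0 \<le> w i" "\<And>i. w i \<le> 1"
  shows "(\<Sum>i | i \<in> {1..m} \<and> j < i + L. w (i + 2 * L)) \<le> (\<Sum>l=Suc j..m. w l) + 2 * L"
proof -
  let ?I = "{i \<in> {1..m}. j < i + L}"
  have "(\<Sum>i\<in>?I. w (i + 2 * L)) = (\<Sum>l\<in>(\<lambda>i. i + 2 * L) ` ?I. w l)"
    by (subst sum.reindex) (auto simp: inj_on_def)
  also have "\<dots> \<le> (\<Sum>l\<in>{Suc j..m} \<union> {Suc m..m + 2 * L}. w l)"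
    using assms by (intro sum_mono2) auto
  also have "\<dots> = (\<Sum>l=Suc j..m. w l) + (\<Sum>l=Suc m..m + 2 * L. w l)"
    by (rule sum.union_disjoint) auto
  also have "(\<Sum>l=Suc m..m + 2 * L. w l) \<le> 2 * L"
    using sum_bounded_above[of "{Suc m..m + 2 * L}" w 1] assms by simp
  finally show ?thesis by simp
qed

section \<open>Testing the drops against a sine\<close>

context ordered_graph
begin

text \<open>Summation by parts turns \<open>weighted_gap_bound\<close> into a comparison of two sums
  over \<open>x\<close>, one with the increments of the sine, the other with its tail sums plus
  \<open>C\<close>. With \<open>\<sigma> = 2 * sin (\<theta> / 2)\<close>, the factor
  \<open>\<sigma>\<^sup>2\<close> makes each tail term at most the increment, and the positive sum
  of increments cancels.\<close>

lemma spectral_gap_lower_bound: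
  fixes x :: "nat \<Rightarrow> real" and \<mu> :: real
  assumes x: "\<And>s t. s \<le> t \<Longrightarrow> t < n \<Longrightarrow> x t \<le> x s" and x0: "\<And>s. s < n \<Longrightarrow> 0 \<le> x s" "0 < x 0"
    and flux: "\<And>i. 1 \<le> i \<Longrightarrow> i \<le> m \<Longrightarrow>
      (\<Sum>s<i. \<Sum>t=i..<n. e s t * (x s - x t)) \<le> \<mu> * (\<Sum>j<i. x j)"
    and ground: "x m \<le> \<mu> * (\<Sum>j\<le>m. x j)"
  shows "a * (4 * (sin (pi / (4 * real (n + 4 * (a + 1) * (a + 4)))))\<^sup>2) \<le> \<mu>"
proof -
  \<comment> \<open>Collects the losses: \<open>2 * L\<close> from index shifts,
    \<open>a * L\<close> from the end of the admissible weight, and \<open>a\<close> from the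
    boundary term at \<open>m\<close>.\<close>
  define C where "C = (a + 1) * (a + 4)"
  define N where "N = n + 4 * C"
  define \<theta> where "\<theta> = pi / (2 * N)"
  define L where "L = a + 2"
  \<comment> \<open>The cap at \<open>N\<close>, where the angle is a right angle, makes the sine
    monotone on all naturals.\<close>
  define \<omega> where "\<omega> k = sin (min k N * \<theta>)" for k
  define S where "S = (\<Sum>j\<le>m. x j)"
  \<comment> \<open>Stopping at \<open>m\<close> keeps \<open>F\<close> below
    \<open>\<mu> * S\<close> even at shifted arguments.\<close>
  define F where "F i = \<mu> * (\<Sum>j | j \<le> m \<and> j < i. x j)" for i
  have C: "2 * L + a + a * L = C" by (simp add: C_def L_def algebra_simps)
  have N: "0 < N" "m < N" using m_less by (auto simp: N_def)
  have N\<theta>: "N * \<theta> = pi / 2" and \<theta>: "0 < \<theta>" using N by (auto simp: \<theta>_def)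
  have le_N\<theta>: "real k * \<theta> \<le> pi / 2" if "k \<le> N" for k
    unfolding N\<theta>[symmetric] using that \<theta> by (intro mult_right_mono) auto
  have xm: "0 \<le> x j" if "j \<le> m" for j using that x0 m_less by auto
  have S: "0 < S" unfolding S_def by (rule sum_pos2[of _ 0]) (simp_all add: x0(2) xm)
  have "0 \<le> \<mu> * S" using ground xm[of m] by (simp add: S_def)
  then have \<mu>: "0 \<le> \<mu>" using S by (simp add: zero_le_mult_iff)
  have \<omega>_mono: "mono \<omega>"
    unfolding \<omega>_def using \<theta> pi_gt_zero
    by (intro monoI sin_monotone_2pi_le le_N\<theta> mult_right_mono)
      (auto intro: order_trans[of _ 0])
  have \<omega>_ge: "0 \<le> \<omega> k" for k using monoD[OF \<omega>_mono, of 0 k] by (simp add: \<omega>_def)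
  have \<omega>_le: "\<omega> k \<le> 1" for k by (simp add: \<omega>_def)
  have F_mono: "mono F" unfolding F_def using \<mu> xm
    by (intro monoI mult_left_mono sum_mono2) auto
  have F_ge: "0 \<le> F i" for i unfolding F_def using \<mu> xm by (intro mult_nonneg_nonneg sum_nonneg) auto
  have F_le: "F i \<le> \<mu> * S" for i
    unfolding F_def S_def using \<mu> xm by (intro mult_left_mono sum_mono2) auto
  have flux': "(\<Sum>s<i. \<Sum>t=i..<n. e s t * (x s - x t)) \<le> F i" if "1 \<le> i" "i \<le> m" for i
  proof -
    have "{j. j \<le> m \<and> j < i} = {..<i}" using that by auto
    then show ?thesis using flux[OF that] by (simp add: F_def)
  qed
  let ?D = "\<lambda>j. \<omega> (Suc j) - \<omega> j"
  let ?T = "\<lambda>j. \<Sum>l=Suc j..m. \<omega> l"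
  have "(\<Sum>j\<le>m. x j * ?D j) = (\<Sum>k=1..m. (x (k - 1) - x k) * \<omega> k) + x m * \<omega> (Suc m)"
    by (rule sum_by_parts[symmetric]) (simp add: \<omega>_def)
  also have "(\<Sum>k=1..m. (x (k - 1) - x k) * \<omega> k)
    \<le> (\<Sum>i=1..m. \<omega> (i + 2 * L) * F (i + L)) / a + L * \<omega> (m + L) * F m"
    using weighted_gap_bound[OF x flux' F_mono F_ge \<omega>_mono \<omega>_ge] by (simp add: L_def)
  also have "L * \<omega> (m + L) * F m \<le> L * 1 * (\<mu> * S)"
    using \<omega>_le \<omega>_ge F_ge F_le by (intro mult_mono) (auto intro!: mult_left_le)
  also have "x m * \<omega> (Suc m) \<le> \<mu> * S * 1"
    using ground \<omega>_le \<omega>_ge xm \<mu> S by (intro mult_mono) (auto simp: S_def)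
  also have "(\<Sum>i=1..m. \<omega> (i + 2 * L) * F (i + L))
      = \<mu> * (\<Sum>i=1..m. \<Sum>j | j \<le> m \<and> j < i + L. \<omega> (i + 2 * L) * x j)"
    by (simp add: F_def sum_distrib_left mult_ac)
  also have "(\<Sum>i=1..m. \<Sum>j | j \<le> m \<and> j < i + L. \<omega> (i + 2 * L) * x j)
      = (\<Sum>j\<le>m. x j * (\<Sum>i | i \<in> {1..m} \<and> j < i + L. \<omega> (i + 2 * L)))"
  proof -
    have "(\<Sum>i\<in>{1..m}. \<Sum>j | j \<in> {..m} \<and> j < i + L. \<omega> (i + 2 * L) * x j)
        = (\<Sum>j\<in>{..m}. \<Sum>i | i \<in> {1..m} \<and> j < i + L. \<omega> (i + 2 * L) * x j)"
      by (rule sum.swap_restrict) auto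
    then show ?thesis by (simp add: sum_distrib_left mult_ac)
  qed
  also have "\<dots> \<le> (\<Sum>j\<le>m. x j * (?T j + 2 * L))"
    using xm \<omega>_ge \<omega>_le shifted_sum_le[of \<omega>] by (intro sum_mono mult_left_mono) auto
  finally have "(\<Sum>j\<le>m. x j * ?D j)
      \<le> \<mu> * (\<Sum>j\<le>m. x j * (?T j + 2 * L)) / a + L * 1 * (\<mu> * S) + \<mu> * S * 1"
    using \<mu> a_pos by (simp add: divide_right_mono mult_left_mono)
  also have "\<dots> = \<mu> / a * (\<Sum>j\<le>m. x j * (?T j + C))"
    using a_pos C[symmetric] by (simp add: S_def sum.distrib distrib_left flip: sum_distrib_right) (simp add: field_simps)
  finally have main: "a * (\<Sum>j\<le>m. x j * ?D j) \<le> \<mu> * (\<Sum>j\<le>m. x j * (?T j + C))"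
    using a_pos by (simp add: field_simps)
  define \<sigma> where "\<sigma> = 2 * sin (\<theta> / 2)"
  have \<theta>2: "\<theta> / 2 < pi / 2" using le_N\<theta>[of 1] N \<theta> pi_gt_zero by simp
  have \<sigma>: "0 < \<sigma>" "\<sigma> \<le> \<theta>"
    using \<theta> \<theta>2 pi_gt_zero sin_x_le_x[of "\<theta> / 2"] by (auto simp: \<sigma>_def intro!: sin_gt_zero)
  \<comment> \<open>The cosine is the sine of the complementary angle, which is at least
    \<open>4 * C * \<theta>\<close> since \<open>N\<close> exceeds \<open>n\<close> by
    \<open>4 * C\<close>. This absorbs the constant \<open>C\<close> in the tail sums.\<close>
  have cosm: "C * \<sigma> \<le> cos ((m + 1 / 2) * \<theta>)"
  proof -
    let ?u = "(real N - (m + 1 / 2)) * \<theta>"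
    have "real m + 1 \<le> real n" using m_less by linarith
    then have big: "4 * real C \<le> real N - (m + 1 / 2)" unfolding N_def by simp
    then have u: "4 * C * \<theta> \<le> ?u" using \<theta> by (intro mult_right_mono) auto
    have u0: "0 \<le> ?u" using big \<theta> by (intro mult_nonneg_nonneg) linarith+
    have "?u \<le> N * \<theta>" using \<theta> by (intro mult_right_mono) auto
    then have "?u / 4 \<le> sin ?u" using u0 by (intro sin_ge_quarter) (auto simp: N\<theta>)
    moreover have "C * \<sigma> \<le> C * \<theta>" using \<sigma> by (intro mult_left_mono) auto
    moreover have "0 \<le> C * \<theta>" using \<theta> by simp
    moreover have "sin ?u = cos ((m + 1 / 2) * \<theta>)"
      unfolding left_diff_distrib N\<theta> by (simp add: cos_sin_eq)
    ultimately show ?thesis using u by linarith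
  qed
  have D: "?D j = \<sigma> * cos ((j + 1 / 2) * \<theta>)" if "j \<le> m" for j
    using sin_diff_arith[of j \<theta>] that N by (simp add: \<omega>_def \<sigma>_def)
  have T: "\<sigma> * ?T j = cos ((j + 1 / 2) * \<theta>) - cos ((m + 1 / 2) * \<theta>)" if "j \<le> m" for j
  proof -
    have "?T j = (\<Sum>l=Suc j..m. sin (real l * \<theta>))"
      using N by (intro sum.cong) (auto simp: \<omega>_def)
    then show ?thesis using sum_sin_arith[OF that, of \<theta>] by (simp add: \<sigma>_def)
  qed
  have key: "\<sigma>\<^sup>2 * (?T j + C) \<le> ?D j" if "j \<le> m" for j
  proof -
    have "\<sigma> * (?T j + C) \<le> cos ((j + 1 / 2) * \<theta>)"
      using T[OF that] cosm by (simp add: distrib_left mult_ac)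
    then have "\<sigma> * (\<sigma> * (?T j + C)) \<le> \<sigma> * cos ((j + 1 / 2) * \<theta>)"
      using \<sigma> by (intro mult_left_mono) auto
    then show ?thesis using D[OF that] by (simp add: power2_eq_square mult_ac)
  qed
  have "a * \<sigma>\<^sup>2 * (\<Sum>j\<le>m. x j * ?D j) \<le> \<mu> * (\<Sum>j\<le>m. x j * (\<sigma>\<^sup>2 * (?T j + C)))"
    using mult_left_mono[OF main, of "\<sigma>\<^sup>2"] by (simp add: sum_distrib_left mult_ac)
  also have "\<dots> \<le> \<mu> * (\<Sum>j\<le>m. x j * ?D j)"
    using \<mu> xm key by (intro mult_left_mono sum_mono) auto
  finally have fin: "a * \<sigma>\<^sup>2 * (\<Sum>j\<le>m. x j * ?D j) \<le> \<mu> * (\<Sum>j\<le>m. x j * ?D j)" .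
  have "0 < ?D 0"
  proof -
    have "0 < \<sigma> * cos (\<theta> / 2)" using \<sigma> \<theta> \<theta>2 by (intro mult_pos_pos cos_gt_zero) auto
    then show ?thesis using D[of 0] by simp
  qed
  then have "0 < (\<Sum>j\<le>m. x j * ?D j)"
    using x0(2) xm monoD[OF \<omega>_mono] by (intro sum_pos2[of _ 0]) auto
  then have "a * \<sigma>\<^sup>2 \<le> \<mu>" using fin by simp
  moreover have "\<theta> / 2 = pi / (4 * real (n + 4 * (a + 1) * (a + 4)))"
  proof -
    have "N = n + 4 * (a + 1) * (a + 4)" by (simp only: N_def C_def mult.assoc)
    then show ?thesis by (simp add: \<theta>_def)
  qed
  ultimately show ?thesis by (simp add: \<sigma>_def power_mult_distrib)
qed

end

subsection \<open>Spectral radius of a nonregular graph\<close>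

definition arc_weight :: "nat pair_pre_digraph \<Rightarrow> nat \<Rightarrow> nat \<Rightarrow> nat" where
  "arc_weight G u v = (if (u, v) \<in> parcs G then 1 else 0)"

lemma antisymmetric_part_cancels:
  fixes e :: "nat \<Rightarrow> nat \<Rightarrow> nat" and x :: "nat \<Rightarrow> real"
  assumes "\<And>s t. e s t = e t s" "i \<le> n"
  shows "(\<Sum>s<i. \<Sum>t<n. e s t * (x s - x t)) = (\<Sum>s<i. \<Sum>t=i..<n. e s t * (x s - x t))"
proof -
  let ?f = "\<lambda>s t. e s t * (x s - x t)"
  have "(\<Sum>s<i. \<Sum>t<i. ?f s t) = (\<Sum>s<i. \<Sum>t<i. ?f t s)" by (rule sum.swap)
  also have "\<dots> = (\<Sum>s<i. \<Sum>t<i. - ?f s t)"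
  proof (intro sum.cong refl)
    show "?f t s = - ?f s t" for s t using assms(1)[of t s] by (simp add: right_diff_distrib)
  qed
  also have "\<dots> = - (\<Sum>s<i. \<Sum>t<i. ?f s t)" by (simp add: sum_negf)
  finally have 0: "(\<Sum>s<i. \<Sum>t<i. ?f s t) = 0" by linarith
  have split: "{..<n} = {..<i} \<union> {i..<n}" using assms(2) by auto
  have "(\<Sum>t<n. ?f s t) = (\<Sum>t<i. ?f s t) + (\<Sum>t=i..<n. ?f s t)" for s
    unfolding split by (rule sum.union_disjoint) auto
  then have "(\<Sum>s<i. \<Sum>t<n. ?f s t) = (\<Sum>s<i. (\<Sum>t<i. ?f s t) + (\<Sum>t=i..<n. ?f s t))" by (rule sum.cong[OF refl])
  then show ?thesis unfolding sum.distrib 0 by simp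
qed

locale nonregular_member =
  fixes G :: "nat pair_pre_digraph" and n \<Delta> :: nat
  assumes mem: "G \<in> nonregular_family n \<Delta>"
begin

lemma pair_graph: "pair_graph G" and verts: "pverts G = {..<n}"
  and connected: "Digraph_Component.connected (with_proj G)"
  and nonregular: "\<not> regular_graph G" and max_degree: "max_degree G = \<Delta>"
  using mem by (simp_all add: nonregular_family_def)

sublocale pair_graph G by (fact pair_graph)

abbreviation "e \<equiv> arc_weight G"

lemma arc_less: "(u, v) \<in> parcs G \<Longrightarrow> u < n \<and> v < n"
  using arc_fst_in_verts[of "(u, v)"] arc_snd_in_verts[of "(u, v)"] verts by auto

lemma arc_sym: "(u, v) \<in> parcs G \<longleftrightarrow> (v, u) \<in> parcs G"
proof -
  have "sym (parcs G)" using pair_sym_arcs by (simp add: symmetric_def)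
  then show ?thesis by (meson symD)
qed

lemma weight_sym: "e u v = e v u" using arc_sym by (simp add: arc_weight_def)

lemma weight_irrefl: "e u u = 0" using pair_no_loops[of "(u, u)"] by (auto simp: arc_weight_def)

lemma weight_le: "e u v \<le> 1" by (simp add: arc_weight_def)

lemma n_pos: "0 < n"
  using nonregular verts by (cases n) (auto simp: regular_graph_def)

lemma degree_eq: "vertex_degree G v = (\<Sum>u<n. e v u)"
proof -
  have "out_arcs (with_proj G) v = Pair v ` {u. u < n \<and> (v, u) \<in> parcs G}"
    using arc_less by (auto simp: out_arcs_def image_iff)
  then have "vertex_degree G v = card {u. u < n \<and> (v, u) \<in> parcs G}"
    by (simp add: out_degree_def card_image inj_on_def)
  also have "\<dots> = (\<Sum>u<n. e v u)"
    unfolding arc_weight_def by (subst sum.If_cases) (auto intro!: arg_cong[of _ _ card])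
  finally show ?thesis .
qed

lemma degree_le: "v < n \<Longrightarrow> (\<Sum>u<n. e v u) \<le> \<Delta>"
  unfolding degree_eq[symmetric] max_degree[symmetric] max_degree_def verts by simp

lemma arc_leaving:
  assumes "S \<subseteq> {..<n}" "u \<in> S" "v < n" "v \<notin> S"
  shows "\<exists>s\<in>S. \<exists>t\<in>{..<n} - S. (s, t) \<in> parcs G"
proof (rule ccontr)
  assume no: "\<not> ?thesis"
  have arcs: "parcs (mk_symmetric (with_proj G)) = parcs G"
    using arc_sym by (auto simp: parcs_mk_symmetric)
  have "(u, v) \<in> rtrancl_on (pverts G) (parcs G)"
    using connected assms verts
    by (auto simp: Digraph_Component.connected_def strongly_connected_def reachable_def arcs)
  then have "v \<in> S"
  proof (induction rule: rtrancl_on_induct)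
    case base then show ?case using assms by simp
  next
    case (step y z)
    then have "z < n" using arc_less[of y z] by simp
    then show ?case using no step by auto
  qed
  then show False using assms by simp
qed

text \<open>Moduli in the eigenvector equation, with the triangle inequality. The resulting
  inequality has the direction needed to bound net outflows from above.\<close>

lemma eigenvalue_inequality:
  obtains w :: "nat \<Rightarrow> real" where "\<And>v. 0 \<le> w v" "\<exists>v<n. 0 < w v"
    "\<And>v. v < n \<Longrightarrow> graph_spectral_radius G * w v \<le> (\<Sum>u<n. e v u * w u)"
proof -
  let ?A = "adjacency_matrix G" and ?r = "graph_spectral_radius G"
  have A: "?A \<in> carrier_mat n n" by (simp add: adjacency_matrix_def verts)
  obtain l where l: "eigenvalue ?A l" "norm l = ?r"
    using spectral_radius_mem_max(1)[OF A n_pos] by (auto simp: graph_spectral_radius_def spectrum_def)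
  then obtain z where z: "z \<in> carrier_vec n" "z \<noteq> 0\<^sub>v n" "?A *\<^sub>v z = l \<cdot>\<^sub>v z"
    using A unfolding eigenvalue_def eigenvector_def by auto
  define w where "w v = norm (z $ v)" for v
  show thesis
  proof
    show "0 \<le> w v" for v by (simp add: w_def)
    show "\<exists>v<n. 0 < w v"
    proof (rule ccontr)
      assume "\<not> ?thesis"
      then have "z $ v = 0" if "v < n" for v using that by (auto simp: w_def)
      then have "z = 0\<^sub>v n" using z(1) by (intro eq_vecI) auto
      then show False using z(2) by simp
    qed
    show "?r * w v \<le> (\<Sum>u<n. e v u * w u)" if v: "v < n" for v
    proof -
      have "l * z $ v = (?A *\<^sub>v z) $ v" using z v by simp
      also have "\<dots> = (\<Sum>u<n. of_nat (e v u) * z $ u)"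
        using v z(1) A verts
        by (auto simp: scalar_prod_def adjacency_matrix_def arc_weight_def lessThan_atLeast0 intro!: sum.cong)
      finally have "norm (l * z $ v) = norm (\<Sum>u<n. of_nat (e v u) * z $ u)" by (rule arg_cong)
      then have "?r * w v = norm (\<Sum>u<n. of_nat (e v u) * z $ u)"
        by (simp only: w_def norm_mult l(2))
      also have "\<dots> \<le> (\<Sum>u<n. e v u * w u)"
        by (rule order_trans[OF norm_sum]) (simp add: w_def norm_mult)
      finally show ?thesis .
    qed
  qed
qed

text \<open>Sorting by decreasing \<open>w\<close> gives an ordered graph. The net outflow of an
  initial segment is a sum over its vertices because the contributions of inner edges cancel in
  pairs.\<close>

lemma spectral_radius_upper_bound:
  assumes a: "\<Delta> = a + 1" "1 \<le> a"
  shows "a * (4 * (sin (pi / (4 * real (n + 4 * (a + 1) * (a + 4)))))\<^sup>2) \<le> \<Delta> - graph_spectral_radius G"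
proof -
  obtain w :: "nat \<Rightarrow> real" where w: "\<And>v. 0 \<le> w v" "\<exists>v<n. 0 < w v"
    and sub: "\<And>v. v < n \<Longrightarrow> graph_spectral_radius G * w v \<le> (\<Sum>u<n. e v u * w u)"
    using eigenvalue_inequality by blast
  define \<mu> where "\<mu> = \<Delta> - graph_spectral_radius G"
  define xs where "xs = sort_key (\<lambda>v. - w v) [0..<n]"
  define \<sigma> where "\<sigma> i = xs ! i" for i
  have xs: "length xs = n" "set xs = {..<n}" "distinct xs" "sorted (map (\<lambda>v. - w v) xs)"
    by (auto simp: xs_def)
  have \<sigma>: "bij_betw \<sigma> {..<n} {..<n}"
  proof -
    have "\<sigma> = (!) xs" by (rule ext) (simp add: \<sigma>_def)
    then show ?thesis using bij_betw_nth[OF xs(3) refl refl] xs(1,2) by simp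
  qed
  have \<sigma>_less: "\<sigma> i < n" if "i < n" for i using \<sigma> that by (auto simp: bij_betw_def)
  have reindex: "(\<Sum>t<n. f (\<sigma> t)) = (\<Sum>u<n. f u)" for f :: "nat \<Rightarrow> 'b::comm_monoid_add"
    by (rule sum.reindex_bij_betw[OF \<sigma>])
  define x where "x i = w (\<sigma> i)" for i
  define e' where "e' s t = e (\<sigma> s) (\<sigma> t)" for s t
  have anti: "x t \<le> x s" if "s \<le> t" "t < n" for s t
    using sorted_nth_mono[OF xs(4), of s t] that xs(1) by (simp add: x_def \<sigma>_def)
  define deficient where "deficient s \<longleftrightarrow> s < n \<and> (\<Sum>t<n. e' s t) \<noteq> \<Delta>" for s
  have deg_eq: "(\<Sum>t<n. e' s t) = vertex_degree G (\<sigma> s)" for s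
    unfolding e'_def degree_eq by (rule reindex)
  have "\<exists>s. deficient s"
  proof -
    obtain v where v: "v < n" "vertex_degree G v \<noteq> \<Delta>"
      using nonregular verts unfolding regular_graph_def by auto
    then obtain s where "s < n" "v = \<sigma> s" using \<sigma> by (auto simp: bij_betw_def)
    then show ?thesis using v deg_eq by (auto simp: deficient_def)
  qed
  define m where "m = (LEAST s. deficient s)"
  have m: "deficient m" unfolding m_def by (rule LeastI_ex) fact
  have m_less: "m < n" using m by (simp add: deficient_def)
  have deg: "(\<Sum>t<n. e' s t) = a + 1" if "s < m" for s
    using not_less_Least[of s deficient] that m_less a by (auto simp: deficient_def m_def)
  have deg_m: "(\<Sum>t<n. e' m t) + 1 \<le> \<Delta>"
    using m degree_le[OF \<sigma>_less[OF m_less]] deg_eq[of m] degree_eq[of "\<sigma> m"] by (simp add: deficient_def)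
  interpret og: ordered_graph e' n m a
  proof
    show "e' s t \<le> 1" "e' s t = e' t s" "e' s s = 0" for s t
      using weight_le weight_sym weight_irrefl by (auto simp: e'_def)
    show "1 \<le> edges_between e' {..<k} {k..<n}" if k: "1 \<le> k" "k \<le> m" for k
    proof -
      have img: "\<sigma> ` {..<k} \<subseteq> {..<n}" using k m_less by (auto intro: \<sigma>_less)
      have inj: "\<sigma> i = \<sigma> j \<longleftrightarrow> i = j" if "i < n" "j < n" for i j
        using \<sigma> that by (auto simp: bij_betw_def inj_on_def)
      have "\<sigma> k \<notin> \<sigma> ` {..<k}" using inj k m_less by auto
      then obtain u v where uv: "u \<in> \<sigma> ` {..<k}" "v \<in> {..<n} - \<sigma> ` {..<k}" "(u, v) \<in> parcs G"
        using arc_leaving[OF img, of "\<sigma> 0" "\<sigma> k"] k m_less \<sigma>_less by auto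
      then obtain s where s: "s < k" "u = \<sigma> s" by auto
      have "v \<in> \<sigma> ` {..<n}" using uv(2) \<sigma> by (auto simp: bij_betw_def)
      then obtain t where t: "t < n" "v = \<sigma> t" by auto
      have "k \<le> t" using uv t by (cases "t < k") auto
      have "1 = e' s t" using uv(3) s t by (simp add: e'_def arc_weight_def)
      also have "\<dots> \<le> (\<Sum>t=k..<n. e' s t)" using t \<open>k \<le> t\<close> by (intro member_le_sum) auto
      also have "\<dots> \<le> (\<Sum>s<k. \<Sum>t=k..<n. e' s t)"
        using s by (intro member_le_sum[of s _ "\<lambda>s. \<Sum>t=k..<n. e' s t"]) auto
      finally show ?thesis by (simp add: edges_between_def)
    qed
  qed (use deg m_less a in auto)
  have sub': "\<Delta> * x s - (\<Sum>t<n. e' s t * x t) \<le> \<mu> * x s" if "s < n" for s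
  proof -
    have "graph_spectral_radius G * x s \<le> (\<Sum>t<n. e' s t * x t)"
      using sub[OF \<sigma>_less[OF that]] reindex[of "\<lambda>u. e (\<sigma> s) u * w u"] by (simp add: x_def e'_def)
    then show ?thesis by (simp add: \<mu>_def algebra_simps)
  qed
  have full: "(\<Sum>t<n. e' s t * (x s - x t)) \<le> \<mu> * x s" if "s < m" for s
  proof -
    have "(\<Sum>t<n. e' s t * (x s - x t)) = (\<Sum>t<n. e' s t) * x s - (\<Sum>t<n. e' s t * x t)"
      by (simp add: right_diff_distrib sum_subtractf sum_distrib_right)
    then show ?thesis using deg[OF that] sub'[of s] that m_less a by simp
  qed
  have "\<mu> \<ge> a * (4 * (sin (pi / (4 * real (n + 4 * (a + 1) * (a + 4)))))\<^sup>2)"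
  proof (rule og.spectral_gap_lower_bound[of x])
    show "0 \<le> x s" for s by (simp add: x_def w)
    show "0 < x 0"
    proof -
      obtain v where "v < n" "0 < w v" using w by blast
      moreover then obtain s where "s < n" "v = \<sigma> s" using \<sigma> by (auto simp: bij_betw_def)
      ultimately show ?thesis using anti[of 0 s] by (simp add: x_def)
    qed
    show "(\<Sum>s<i. \<Sum>t=i..<n. e' s t * (x s - x t)) \<le> \<mu> * (\<Sum>j<i. x j)" if "1 \<le> i" "i \<le> m" for i
    proof -
      have "(\<Sum>s<i. \<Sum>t<n. e' s t * (x s - x t)) \<le> (\<Sum>s<i. \<mu> * x s)"
        using that by (intro sum_mono full) auto
      then show ?thesis
        using antisymmetric_part_cancels[of e' i n x] og.e_sym that m_less by (simp add: sum_distrib_left)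
    qed
    show "x m \<le> \<mu> * (\<Sum>j\<le>m. x j)"
    proof -
      have "(\<Sum>t<n. e' m t * (x m - x t)) + x m \<le> \<mu> * x m"
      proof -
        have "(\<Sum>t<n. e' m t * (x m - x t)) + x m = real ((\<Sum>t<n. e' m t) + 1) * x m - (\<Sum>t<n. e' m t * x t)"
          by (simp add: right_diff_distrib sum_subtractf sum_distrib_right distrib_right)
        moreover have "real ((\<Sum>t<n. e' m t) + 1) * x m \<le> \<Delta> * x m"
          using deg_m by (intro mult_right_mono of_nat_mono) (auto simp: x_def w)
        ultimately show ?thesis using sub'[OF m_less] by linarith
      qed
      moreover have "(\<Sum>s<m. \<Sum>t<n. e' s t * (x s - x t)) \<le> (\<Sum>s<m. \<mu> * x s)"
        by (intro sum_mono full) auto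
      ultimately have "(\<Sum>s<Suc m. \<Sum>t<n. e' s t * (x s - x t)) + x m \<le> (\<Sum>s<Suc m. \<mu> * x s)"
        by simp
      moreover have "0 \<le> (\<Sum>s<Suc m. \<Sum>t=Suc m..<n. e' s t * (x s - x t))"
        using anti by (intro sum_nonneg mult_nonneg_nonneg) auto
      ultimately show ?thesis
        using antisymmetric_part_cancels[of e' "Suc m" n x] og.e_sym m_less
        by (simp add: sum_distrib_left lessThan_Suc_atMost del: sum.lessThan_Suc)
    qed
  qed (rule anti)
  then show ?thesis by (simp add: \<mu>_def)
qed

end

subsection \<open>The Rayleigh quotient bounds the spectral radius from below\<close>

definition apply_kernel :: "nat \<Rightarrow> (nat \<Rightarrow> nat \<Rightarrow> real) \<Rightarrow> (nat \<Rightarrow> real) \<Rightarrow> nat \<Rightarrow> real" where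
  "apply_kernel n S f i = (\<Sum>u<n. S i u * f u)"

text \<open>Links real iterates, to which Cauchy-Schwarz applies, with powers of the complex matrix,
  whose growth is governed by the spectral radius.\<close>

lemma kernel_power_eq_mat_power:
  fixes S :: "nat \<Rightarrow> nat \<Rightarrow> real" and n :: nat
  defines "M \<equiv> mat n n (\<lambda>(i, j). complex_of_real (S i j))"
  assumes "i < n"
  shows "complex_of_real ((apply_kernel n S ^^ k) x i) = (M ^\<^sub>m k *\<^sub>v vec n (\<lambda>j. complex_of_real (x j))) $ i"
proof (induction k arbitrary: x)
  case 0
  then show ?case using assms by simp
next
  case (Suc k)
  have M: "M \<in> carrier_mat n n" by (simp add: M_def)
  have "vec n (\<lambda>j. complex_of_real (apply_kernel n S x j)) = M *\<^sub>v vec n (\<lambda>j. complex_of_real (x j))"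
    by (rule eq_vecI) (auto simp: M_def apply_kernel_def scalar_prod_def lessThan_atLeast0)
  then show ?case using Suc[of "apply_kernel n S x"] M
    by (simp add: funpow_swap1 assoc_mult_mat_vec[of _ n n M n])
qed

lemma kernel_power_bounded:
  fixes S :: "nat \<Rightarrow> nat \<Rightarrow> real" and n :: nat
  assumes "spectral_radius (mat n n (\<lambda>(i, j). complex_of_real (S i j))) < 1"
  obtains C where "\<And>k i. i < n \<Longrightarrow> \<bar>(apply_kernel n S ^^ k) x i\<bar> \<le> C"
proof -
  let ?M = "mat n n (\<lambda>(i, j). complex_of_real (S i j))"
  have M: "?M \<in> carrier_mat n n" by simp
  obtain c where c: "\<And>k. norm_bound (?M ^\<^sub>m k) c"
    using spectral_radius_jnf_norm_bound_less_1_upper_triangular[OF M assms] by blast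
  have "\<bar>(apply_kernel n S ^^ k) x i\<bar> \<le> (\<Sum>j<n. c * \<bar>x j\<bar>)" if i: "i < n" for k i
  proof -
    have dim: "dim_row (?M ^\<^sub>m k) = n" "dim_col (?M ^\<^sub>m k) = n" by simp_all
    have "\<bar>(apply_kernel n S ^^ k) x i\<bar> = norm (complex_of_real ((apply_kernel n S ^^ k) x i))" by simp
    also have "\<dots> = norm (\<Sum>j<n. (?M ^\<^sub>m k) $$ (i, j) * x j)"
      unfolding kernel_power_eq_mat_power[OF i] using i dim
      by (simp add: scalar_prod_def lessThan_atLeast0)
    also have "\<dots> \<le> (\<Sum>j<n. c * \<bar>x j\<bar>)"
      using c[of k] i dim
      by (rule_tac order_trans[OF norm_sum], rule_tac sum_mono) (auto simp: norm_mult norm_bound_def intro!: mult_right_mono)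
    finally show ?thesis .
  qed
  then show ?thesis using that by blast
qed

definition dot :: "nat \<Rightarrow> (nat \<Rightarrow> real) \<Rightarrow> (nat \<Rightarrow> real) \<Rightarrow> real" where
  "dot n f g = (\<Sum>i<n. f i * g i)"

lemma dot_kernel_power:
  assumes sym: "\<And>i j. S i j = S j i"
  shows "dot n f ((apply_kernel n S ^^ k) g) = dot n ((apply_kernel n S ^^ k) f) g"
proof (induction k arbitrary: f g)
  case (Suc k)
  have "dot n f (apply_kernel n S g) = dot n (apply_kernel n S f) g" for f g
  proof -
    have "dot n f (apply_kernel n S g) = (\<Sum>i<n. \<Sum>j<n. f i * (S i j * g j))"
      by (simp add: dot_def apply_kernel_def sum_distrib_left)
    also have "\<dots> = (\<Sum>j<n. \<Sum>i<n. f i * (S i j * g j))" by (rule sum.swap)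
    also have "\<dots> = (\<Sum>j<n. \<Sum>i<n. S j i * f i * g j)"
      by (intro sum.cong refl) (simp add: sym[of _ "_::nat"] mult_ac)
    also have "\<dots> = dot n (apply_kernel n S f) g"
      by (simp add: dot_def apply_kernel_def sum_distrib_right)
    finally show ?thesis .
  qed
  then show ?case using Suc by (simp add: funpow_swap1)
qed simp

text \<open>By symmetry and Cauchy-Schwarz the moments
  \<open>q j = dot n x ((apply_kernel n S ^^ j) x)\<close> satisfy
  \<open>(q j)\<^sup>2 \<le> q 0 * q (2 * j)\<close>; iterate along powers of two.\<close>

lemma dot_power_growth:
  assumes sym: "\<And>i j. S i j = S j i" and q0: "0 < dot n x x"
    and q1: "0 \<le> dot n x (apply_kernel n S x)"
  shows "(dot n x (apply_kernel n S x) / dot n x x) ^ (2 ^ k) \<le> dot n x ((apply_kernel n S ^^ (2 ^ k)) x) / dot n x x"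
proof (induction k)
  case (Suc k)
  let ?T = "apply_kernel n S" and ?q = "\<lambda>k. dot n x ((apply_kernel n S ^^ k) x)"
  have "(?q (2 ^ k))\<^sup>2 \<le> dot n x x * dot n ((?T ^^ (2 ^ k)) x) ((?T ^^ (2 ^ k)) x)"
    using Cauchy_Schwarz_ineq_sum[of x "(?T ^^ (2 ^ k)) x" "{..<n}"] by (simp add: dot_def power2_eq_square)
  also have "dot n ((?T ^^ (2 ^ k)) x) ((?T ^^ (2 ^ k)) x) = ?q (2 ^ Suc k)"
    by (simp add: dot_kernel_power[OF sym, symmetric] mult_2 funpow_add)
  finally have "(?q (2 ^ k) / dot n x x)\<^sup>2 \<le> ?q (2 ^ Suc k) / dot n x x"
    using q0 by (simp add: field_simps power2_eq_square)
  moreover have "((?q 1 / dot n x x) ^ (2 ^ k))\<^sup>2 \<le> (?q (2 ^ k) / dot n x x)\<^sup>2"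
    using Suc q0 q1 by (intro power_mono) auto
  ultimately show ?case by (simp add: power_mult mult.commute[of 2])
qed simp

text \<open>If the Rayleigh quotient exceeded the spectral radius, divide the matrix by some
  \<open>r\<close> strictly between them. The scaled powers stay bounded, yet by
  \<open>dot_power_growth\<close> the moments grow at least like powers of a number above 1.\<close>

lemma quadratic_form_le_spectral_radius:
  fixes B :: "nat \<Rightarrow> nat \<Rightarrow> real" and n :: nat
  defines "A \<equiv> mat n n (\<lambda>(i, j). complex_of_real (B i j))"
  assumes sym: "\<And>i j. B i j = B j i"
  shows "(\<Sum>i<n. \<Sum>j<n. B i j * x i * x j) \<le> spectral_radius A * (\<Sum>i<n. (x i)\<^sup>2)"
proof (cases "dot n x x = 0")
  case True
  then have "\<forall>i<n. x i = 0" by (auto simp: dot_def sum_nonneg_eq_0_iff)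
  then show ?thesis by simp
next
  case False
  then have q0: "0 < dot n x x" 
    using sum_nonneg[of "{..<n}" "\<lambda>i. x i * x i"] by (simp add: dot_def less_le)
  then have n: "0 < n" by (cases n) (auto simp: dot_def)
  have A: "A \<in> carrier_mat n n" by (simp add: A_def)
  let ?\<rho> = "spectral_radius A" and ?Q = "dot n x (apply_kernel n B x)"
  have "?Q \<le> ?\<rho> * dot n x x"
  proof (rule ccontr)
    assume "\<not> ?thesis"
    then have "?\<rho> < ?Q / dot n x x" using q0 by (simp add: field_simps)
    then obtain r where r: "?\<rho> < r" "r < ?Q / dot n x x" using dense by blast
    have "0 \<le> ?\<rho>" using spectral_radius_mem_max(1)[OF A n] by auto
    then have r0: "0 < r" using r by simp
    define S where "S i j = B i j / r" for i j
    let ?M = "mat n n (\<lambda>(i, j). complex_of_real (S i j))"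
    have M: "?M \<in> carrier_mat n n" by simp
    have "spectral_radius ?M < 1"
    proof -
      obtain l where l: "eigenvalue ?M l" "norm l = spectral_radius ?M"
        using spectral_radius_mem_max(1)[OF M n] by (auto simp: spectrum_def)
      then obtain z where z: "z \<in> carrier_vec n" "z \<noteq> 0\<^sub>v n" "?M *\<^sub>v z = l \<cdot>\<^sub>v z"
        unfolding eigenvalue_def eigenvector_def by auto
      have "A *\<^sub>v z = (r * l) \<cdot>\<^sub>v z"
      proof (rule eq_vecI)
        fix i assume "i < dim_vec ((r * l) \<cdot>\<^sub>v z)"
        then have i: "i < n" using z(1) by simp
        have "(A *\<^sub>v z) $ i = (\<Sum>j<n. complex_of_real (B i j) * z $ j)"
          using i z(1) by (simp add: A_def scalar_prod_def lessThan_atLeast0)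
        also have "\<dots> = r * (\<Sum>j<n. complex_of_real (S i j) * z $ j)"
          using r0 by (simp add: S_def sum_distrib_left)
        also have "(\<Sum>j<n. complex_of_real (S i j) * z $ j) = (?M *\<^sub>v z) $ i"
          using i z(1) by (simp add: scalar_prod_def lessThan_atLeast0)
        also have "\<dots> = l * z $ i" unfolding z(3) using i z(1) by simp
        finally show "(A *\<^sub>v z) $ i = ((r * l) \<cdot>\<^sub>v z) $ i" using i z(1) by simp
      qed (use A z(1) in auto)
      then have "eigenvalue A (r * l)" using z A unfolding eigenvalue_def eigenvector_def by auto
      then have "norm (r * l) \<le> ?\<rho>"
        by (intro spectral_radius_mem_max(2)[OF A n]) (auto simp: spectrum_def)
      then have "r * spectral_radius ?M \<le> ?\<rho>" using l r0 by (simp add: norm_mult)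
      then have "r * spectral_radius ?M < r" using r by linarith
      then show ?thesis using r0 by simp
    qed
    then obtain C where C: "\<And>k i. i < n \<Longrightarrow> \<bar>(apply_kernel n S ^^ k) x i\<bar> \<le> C"
      using kernel_power_bounded[of n S x] by blast
    define K where "K = (\<Sum>i<n. \<bar>x i\<bar> * C) / dot n x x"
    define \<beta> where "\<beta> = dot n x (apply_kernel n S x) / dot n x x"
    have Q: "dot n x (apply_kernel n S x) = ?Q / r"
      by (simp add: dot_def apply_kernel_def S_def sum_divide_distrib sum_distrib_left)
    have "dot n x x < ?Q / r" using r(2) r0 q0 by (simp add: field_simps)
    then have \<beta>: "1 < \<beta>" unfolding \<beta>_def Q using q0 by (subst less_divide_eq_1_pos)
    have "\<beta> ^ (2 ^ k) \<le> K" for k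
    proof -
      have "\<beta> ^ (2 ^ k) \<le> dot n x ((apply_kernel n S ^^ (2 ^ k)) x) / dot n x x"
        unfolding \<beta>_def
      proof (rule dot_power_growth[OF _ q0])
        show "0 \<le> dot n x (apply_kernel n S x)" using \<open>dot n x x < ?Q / r\<close> q0 unfolding Q by linarith
        show "S i j = S j i" for i j using sym by (simp add: S_def)
      qed
      also have "\<dots> \<le> K" unfolding K_def
      proof (rule divide_right_mono)
        have "x i * (apply_kernel n S ^^ (2 ^ k)) x i \<le> \<bar>x i\<bar> * C" if "i < n" for i
          using C[OF that, of "2 ^ k"] by (rule_tac order_trans[OF abs_ge_self]) (simp add: abs_mult mult_left_mono)
        then show "dot n x ((apply_kernel n S ^^ (2 ^ k)) x) \<le> (\<Sum>i<n. \<bar>x i\<bar> * C)"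
          unfolding dot_def by (intro sum_mono) auto
      qed (use q0 in auto)
      finally show ?thesis .
    qed
    moreover obtain k where "K < \<beta> ^ k" using real_arch_pow[OF \<beta>] by blast
    moreover have "\<beta> ^ k \<le> \<beta> ^ (2 ^ k)" for k using \<beta> by (intro power_increasing) (auto intro: less_imp_le)
    ultimately show False by (meson not_le order_trans)
  qed
  then show ?thesis
    by (simp add: dot_def apply_kernel_def sum_distrib_left power2_eq_square mult_ac)
qed

subsection \<open>Chains of nearly complete graphs\<close>

text \<open>
  For even \<^term>\<open>a\<close> an infinite \<open>(a + 1)\<close>-regular graph on the naturals. The head \<open>{..<a + 3}\<close> is the
  complement of a path on three vertices with centre \<open>a + 2\<close> and a perfect matching
  \<open>t \<leftrightarrow> t + a / 2\<close> of the rest; it is followed by blocks of \<open>a + 2\<close> vertices, each a complete graph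
  without the edge joining its first and its last vertex. Consecutive numbers are always adjacent,
  so every initial segment is connected, and its last vertex has lost a neighbour.
\<close>

definition chain_forward :: "nat \<Rightarrow> nat \<Rightarrow> nat \<Rightarrow> bool" where
  "chain_forward a s t \<longleftrightarrow> s < t \<and> (t = s + 1
     \<or> t < a + 3 \<and> \<not> (t = a + 2 \<and> s \<le> 1) \<and> \<not> (2 \<le> s \<and> t = s + a div 2 \<and> t \<le> a + 1)
     \<or> a + 3 \<le> s \<and> (s - (a + 3)) div (a + 2) = (t - (a + 3)) div (a + 2) \<and> t \<noteq> s + a + 1)"

definition chain_adj :: "nat \<Rightarrow> nat \<Rightarrow> nat \<Rightarrow> bool" where
  "chain_adj a s t \<longleftrightarrow> chain_forward a s t \<or> chain_forward a t s"

definition chain_graph :: "nat \<Rightarrow> nat \<Rightarrow> nat pair_pre_digraph" where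
  "chain_graph a n = \<lparr>pverts = {..<n}, parcs = {(s, t). s < n \<and> t < n \<and> chain_adj a s t}\<rparr>"

section \<open>Block structure and regularity of the infinite chain\<close>

locale chain =
  fixes a :: nat
  assumes even_a: "even a" and a_ge: "4 \<le> a"
begin

definition block_start :: "nat \<Rightarrow> nat" where
  "block_start i = a + 3 + i * (a + 2)"

lemma block_start_ge: "a + 3 \<le> block_start i" by (simp add: block_start_def)

lemma block_start_Suc: "block_start (Suc i) = block_start i + (a + 2)"
  by (simp add: block_start_def)

lemma block_index:
  assumes "a + 3 \<le> t"
  shows "(t - (a + 3)) div (a + 2) = i \<longleftrightarrow> block_start i \<le> t \<and> t < block_start i + (a + 2)"
proof -
  have "(t - (a + 3)) div (a + 2) = i \<longleftrightarrow> i * (a + 2) \<le> t - (a + 3) \<and> t - (a + 3) < Suc i * (a + 2)"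
    by (metis Suc_eq_plus1 add_gr_0 div_nat_eqI dividend_less_times_div less_eq_nat.simps(1) mult.commute
        pos2 times_div_less_eq_dividend zero_less_numeral mult_Suc add.commute)
  also have "\<dots> \<longleftrightarrow> block_start i \<le> t \<and> t < block_start i + (a + 2)"
    using assms by (auto simp: block_start_def)
  finally show ?thesis .
qed

lemma block_cases:
  assumes "a + 3 \<le> t"
  obtains i k where "t = block_start i + k" "k < a + 2"
proof
  let ?i = "(t - (a + 3)) div (a + 2)"
  have "block_start ?i \<le> t" "t < block_start ?i + (a + 2)" using block_index[OF assms] by auto
  then show "t = block_start ?i + (t - block_start ?i)" "t - block_start ?i < a + 2" by auto
qed

lemma forward_to_block:
  assumes "k < a + 2"
  shows "chain_forward a s (block_start i + k) \<longleftrightarrow>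
    s + 1 = block_start i + k \<or> block_start i \<le> s \<and> s < block_start i + k \<and> block_start i + k \<noteq> s + a + 1"
proof (cases "a + 3 \<le> s")
  case True
  have "(block_start i + k - (a + 3)) div (a + 2) = i"
    using block_index[of "block_start i + k" i] block_start_ge[of i] assms by simp
  then show ?thesis using True block_index[OF True, of i] assms block_start_ge[of i]
    unfolding chain_forward_def by auto
next
  case False
  then show ?thesis using block_start_ge[of i] unfolding chain_forward_def by auto
qed

lemma forward_from_block:
  assumes "k < a + 2"
  shows "chain_forward a (block_start i + k) t \<longleftrightarrow>
    t = block_start i + k + 1 \<or> block_start i + k < t \<and> t < block_start i + (a + 2) \<and> t \<noteq> block_start i + k + a + 1"
proof (cases "a + 3 \<le> t")
  case True
  have "(block_start i + k - (a + 3)) div (a + 2) = i"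
    using block_index[of "block_start i + k" i] block_start_ge[of i] assms by simp
  moreover have "i = (t - (a + 3)) div (a + 2) \<longleftrightarrow> block_start i \<le> t \<and> t < block_start i + (a + 2)"
    using block_index[OF True, of i] by auto
  ultimately show ?thesis using True assms block_start_ge[of i]
    unfolding chain_forward_def by auto
next
  case False
  then show ?thesis using block_start_ge[of i] unfolding chain_forward_def by auto
qed

lemma forward_head:
  assumes "t < a + 3"
  shows "chain_forward a s t \<longleftrightarrow> s < t \<and> \<not> (t = a + 2 \<and> s \<le> 1) \<and> \<not> (2 \<le> s \<and> t = s + a div 2 \<and> t \<le> a + 1)"
proof -
  \<comment> \<open>Matched vertices are thus at least two apart, so the disjunct
    \<open>t = s + 1\<close> never contradicts the nonedges of the head.\<close>
  have "2 \<le> a div 2" using a_ge by simp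
  then show ?thesis using assms a_ge unfolding chain_forward_def by auto
qed

lemma forward_head_exit:
  assumes "s < a + 3" "a + 3 \<le> t"
  shows "chain_forward a s t \<longleftrightarrow> s = a + 2 \<and> t = a + 3"
  using assms unfolding chain_forward_def by auto

text \<open>In a block the removed edge costs each of its ends one neighbour and a bridge restores
  it. In the head every vertex has one nonneighbour, except the centre \<open>a + 2\<close>, which
  has two and receives the first bridge.\<close>

lemma neighbours_card: "finite {t. chain_adj a s t} \<and> card {t. chain_adj a s t} = a + 1"
proof (cases "a + 3 \<le> s")
  case True
  then obtain i k where s: "s = block_start i + k" and k: "k < a + 2" by (rule block_cases)
  define B where "B = block_start i"
  have B: "a + 3 \<le> B" using block_start_ge by (simp add: B_def)
  have adj: "chain_adj a s t \<longleftrightarrow> (t + 1 = B + k \<or> B \<le> t \<and> t < B + k \<and> B + k \<noteq> t + a + 1)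
      \<or> (t = B + k + 1 \<or> B + k < t \<and> t < B + (a + 2) \<and> t \<noteq> B + k + a + 1)" for t
    unfolding chain_adj_def s forward_to_block[OF k] forward_from_block[OF k] B_def by blast
  consider "k = 0" | "1 \<le> k" "k \<le> a" | "k = a + 1" using k by linarith
  then show ?thesis
  proof cases
    case 1
    have "{t. chain_adj a s t} = insert (B - 1) {B + 1..B + a}"
      unfolding adj 1 using B a_ge by auto
    then show ?thesis by simp
  next
    case 2
    have "{t. chain_adj a s t} = {B..B + a + 1} - {B + k}"
      unfolding adj using B 2 by auto
    then show ?thesis using 2 by simp
  next
    case 3
    have "{t. chain_adj a s t} = insert (B + a + 2) {B + 1..B + a}"
      unfolding adj 3 using B a_ge by auto
    then show ?thesis by simp
  qed
next
  case False
  define b where "b = a div 2"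
  have b: "a = 2 * b" "2 \<le> b" using even_a a_ge by (auto simp: b_def)
  have adj: "chain_adj a s t \<longleftrightarrow> 
      (if t < a + 3 then 
         (s < t \<and> \<not> (t = a + 2 \<and> s \<le> 1) \<and> \<not> (2 \<le> s \<and> t = s + b \<and> t \<le> a + 1)) \<or>
         (t < s \<and> \<not> (s = a + 2 \<and> t \<le> 1) \<and> \<not> (2 \<le> t \<and> s = t + b \<and> s \<le> a + 1))
       else s = a + 2 \<and> t = a + 3)" for t
  proof (cases "t < a + 3")
    case True
    then show ?thesis using False by (simp add: chain_adj_def forward_head b_def)
  next
    case t: False
    then have "\<not> chain_forward a t s" using False by (auto simp: chain_forward_def)
    then show ?thesis using False t by (simp add: chain_adj_def forward_head_exit)
  qed
  consider "s = 0" | "s = 1" | "2 \<le> s" "s \<le> b + 1" | "b + 2 \<le> s" "s \<le> a + 1" | "s = a + 2"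
    using False by linarith
  then show ?thesis
  proof cases
    case 1
    have "{t. chain_adj a s t} = {1..a + 1}" unfolding adj using 1 a_ge by (auto split: if_splits)
    then show ?thesis by simp
  next
    case 2
    have "{t. chain_adj a s t} = insert 0 {2..a + 1}" unfolding adj using 2 a_ge by (auto split: if_splits)
    then show ?thesis by simp
  next
    case 3
    have "{t. chain_adj a s t} = {0..a + 2} - {s, s + b}" unfolding adj using b 3 by (auto split: if_splits)
    then show ?thesis using b 3 by (simp add: card_Diff_subset)
  next
    case 4
    have "{t. chain_adj a s t} = {0..a + 2} - {s, s - b}" unfolding adj using b 4 by (auto split: if_splits)
    then show ?thesis using b 4 by (simp add: card_Diff_subset)
  next
    case 5
    have "{t. chain_adj a s t} = insert (a + 3) {2..a + 1}" unfolding adj using 5 b by (auto split: if_splits)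
    then show ?thesis by simp
  qed
qed

section \<open>Initial segments of the chain as members of the family\<close>

lemma adj_sym: "chain_adj a s t \<longleftrightarrow> chain_adj a t s" by (auto simp: chain_adj_def)

lemma adj_irrefl: "\<not> chain_adj a s s" by (simp add: chain_adj_def chain_forward_def)

lemma adj_Suc: "chain_adj a s (Suc s)" by (simp add: chain_adj_def chain_forward_def)

lemma arcs_chain: "(s, t) \<in> parcs (chain_graph a n) \<longleftrightarrow> s < n \<and> t < n \<and> chain_adj a s t"
  by (simp add: chain_graph_def)

lemma degree_chain:
  assumes "s < n"
  shows "vertex_degree (chain_graph a n) s = card {t. t < n \<and> chain_adj a s t}"
proof -
  have "out_arcs (with_proj (chain_graph a n)) s = Pair s ` {t. t < n \<and> chain_adj a s t}"
    using assms by (auto simp: out_arcs_def arcs_chain image_iff)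
  then show ?thesis by (simp add: out_degree_def card_image inj_on_def)
qed

lemma degree_chain_le:
  assumes "s < n" shows "vertex_degree (chain_graph a n) s \<le> a + 1"
proof -
  have "card {t. t < n \<and> chain_adj a s t} \<le> card {t. chain_adj a s t}"
    using neighbours_card[of s] by (intro card_mono) auto
  then show ?thesis using degree_chain[OF assms] neighbours_card[of s] by simp
qed

lemma degree_chain_eq:
  assumes "s < n" "\<And>t. chain_adj a s t \<Longrightarrow> t < n"
  shows "vertex_degree (chain_graph a n) s = a + 1"
proof -
  have "{t. t < n \<and> chain_adj a s t} = {t. chain_adj a s t}" using assms by auto
  then show ?thesis using degree_chain[OF assms(1)] neighbours_card[of s] by simp
qed

text \<open>Cutting inside a block is allowed, so all residues of \<open>n\<close> are covered.
  Vertex 0 attains the maximum degree, as its neighbours lie in the head.\<close>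

lemma chain_graph_mem:
  assumes n: "a + 3 \<le> n"
  shows "chain_graph a n \<in> nonregular_family n (a + 1)"
proof -
  let ?G = "chain_graph a n"
  have verts: "pverts ?G = {..<n}" by (simp add: chain_graph_def)
  have fin: "finite (parcs ?G)"
    by (rule finite_subset[of _ "{..<n} \<times> {..<n}"]) (auto simp: chain_graph_def)
  have pair_graph: "pair_graph ?G"
  proof
    show "symmetric (with_proj ?G)"
      using adj_sym by (auto simp: symmetric_def sym_def arcs_chain)
  qed (use fin adj_irrefl in \<open>auto simp: chain_graph_def\<close>)
  interpret pair_graph ?G by (fact pair_graph)
  have reach: "(0, t) \<in> rtrancl_on {..<n} (parcs ?G)" "(t, 0) \<in> rtrancl_on {..<n} (parcs ?G)" if "t < n" for t
    using that
  proof (induction t)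
    case 0
    {
      case 1 then show ?case by (auto intro: rtrancl_on_refl)
    next
      case 2 then show ?case by (auto intro: rtrancl_on_refl)
    }
  next
    case (Suc t)
    {
      case 1
      then show ?case using Suc(1) adj_Suc[of t]
        by (auto intro!: rtrancl_on_into_rtrancl_on[of 0 t] simp: arcs_chain)
    next
      case 2
      then show ?case using Suc(2) adj_Suc[of t] adj_sym[of t "Suc t"]
        by (auto intro!: converse_rtrancl_on_into_rtrancl_on[of "Suc t" t] simp: arcs_chain)
    }
  qed
  have arcs: "parcs (mk_symmetric (with_proj ?G)) = parcs ?G"
    using adj_sym by (auto simp: parcs_mk_symmetric arcs_chain)
  have "{..<n} \<noteq> {}" using n by (simp add: lessThan_empty_iff)
  then have conn: "Digraph_Component.connected (with_proj ?G)"
    unfolding Digraph_Component.connected_def strongly_connected_def reachable_def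
    by (auto simp: arcs verts intro: rtrancl_on_trans[OF reach(2) reach(1)])
  have deg0: "vertex_degree ?G 0 = a + 1"
    using n by (intro degree_chain_eq) (auto simp: chain_adj_def chain_forward_def)
  have "vertex_degree ?G (n - 1) < a + 1"
  proof -
    have "chain_adj a (n - 1) n" using adj_Suc[of "n - 1"] n by simp
    then have "card {t. t < n \<and> chain_adj a (n - 1) t} < card {t. chain_adj a (n - 1) t}"
      using neighbours_card[of "n - 1"] by (intro psubset_card_mono) auto
    then show ?thesis using degree_chain[of "n - 1" n] neighbours_card[of "n - 1"] n by simp
  qed
  then have nonreg: "\<not> regular_graph ?G"
  proof (intro notI)
    assume "regular_graph ?G" and less: "vertex_degree ?G (n - 1) < a + 1"
    then obtain d where "\<And>v. v < n \<Longrightarrow> vertex_degree ?G v = d"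
      unfolding regular_graph_def verts by auto
    from this[of 0] this[of "n - 1"] show False using deg0 less n by simp
  qed
  have "max_degree ?G = a + 1"
    unfolding max_degree_def verts
  proof (rule Max_eqI)
    show "a + 1 \<in> vertex_degree ?G ` {..<n}" using deg0 n by (intro image_eqI[of _ _ 0]) auto
  qed (use degree_chain_le in auto)
  then show ?thesis using pair_graph verts conn nonreg by (simp add: nonregular_family_def)
qed

end

subsection \<open>The Dirichlet energy of a cosine along the chain\<close>

lemma sum_symmetric_pairs:
  fixes f :: "nat \<Rightarrow> nat \<Rightarrow> real"
  assumes "\<And>s t. f s t = f t s" "\<And>s. f s s = 0"
  shows "(\<Sum>s<n. \<Sum>t<n. f s t) = 2 * (\<Sum>t<n. \<Sum>s<t. f s t)"
proof (induction n)
  case (Suc n)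
  have "(\<Sum>s<Suc n. \<Sum>t<Suc n. f s t) = (\<Sum>s<n. \<Sum>t<n. f s t) + (\<Sum>s<n. f s n) + (\<Sum>t<n. f n t)"
    using assms(2) by (simp add: sum.distrib)
  also have "(\<Sum>t<n. f n t) = (\<Sum>s<n. f s n)" using assms(1) by (rule sum.cong[OF refl])
  finally show ?case using Suc by simp
qed simp

text \<open>The usual edge-energy identity. The degree condition is restricted to the support of
  \<open>x\<close> because the cut end of the chain is not regular.\<close>

lemma dirichlet_form:
  fixes B :: "nat \<Rightarrow> nat \<Rightarrow> real" and x :: "nat \<Rightarrow> real"
  assumes sym: "\<And>s t. B s t = B t s"
    and deg: "\<And>s. s < n \<Longrightarrow> x s \<noteq> 0 \<Longrightarrow> (\<Sum>t<n. B s t) = d"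
  shows "d * (\<Sum>s<n. (x s)\<^sup>2) - (\<Sum>s<n. \<Sum>t<n. B s t * x s * x t)
    = (\<Sum>t<n. \<Sum>s<t. B s t * (x s - x t)\<^sup>2)"
proof -
  have "d * (x s)\<^sup>2 = (\<Sum>t<n. B s t * (x s)\<^sup>2)" if "s < n" for s
    using deg[OF that] by (cases "x s = 0") (auto simp flip: sum_distrib_right)
  then have d: "d * (\<Sum>s<n. (x s)\<^sup>2) = (\<Sum>s<n. \<Sum>t<n. B s t * (x s)\<^sup>2)"
    by (simp add: sum_distrib_left)
  have "(\<Sum>s<n. \<Sum>t<n. B s t * (x s - x t)\<^sup>2)
      = (\<Sum>s<n. \<Sum>t<n. B s t * (x s)\<^sup>2) + (\<Sum>s<n. \<Sum>t<n. B s t * (x t)\<^sup>2) - 2 * (\<Sum>s<n. \<Sum>t<n. B s t * x s * x t)"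
    by (simp add: power2_diff algebra_simps sum.distrib sum_subtractf sum_distrib_left)
  also have "(\<Sum>s<n. \<Sum>t<n. B s t * (x t)\<^sup>2) = (\<Sum>s<n. \<Sum>t<n. B s t * (x s)\<^sup>2)"
    by (subst sum.swap) (simp add: sym[of _ "_::nat"])
  finally have "(\<Sum>s<n. \<Sum>t<n. B s t * (x s - x t)\<^sup>2)
      = 2 * (d * (\<Sum>s<n. (x s)\<^sup>2) - (\<Sum>s<n. \<Sum>t<n. B s t * x s * x t))"
    unfolding d by simp
  moreover have "(\<Sum>s<n. \<Sum>t<n. B s t * (x s - x t)\<^sup>2) = 2 * (\<Sum>t<n. \<Sum>s<t. B s t * (x s - x t)\<^sup>2)"
    by (rule sum_symmetric_pairs) (simp_all add: sym power2_commute)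
  ultimately show ?thesis by simp
qed

lemma cos_increment_bound:
  fixes p q r \<theta> :: real
  assumes "0 \<le> p" "p \<le> q" "q \<le> r" "0 \<le> \<theta>" "r * \<theta> \<le> pi / 2"
  shows "\<bar>cos (p * \<theta>) - cos (q * \<theta>)\<bar> \<le> (q - p) * (\<theta> * sin (r * \<theta>))"
proof (cases "p * \<theta> < q * \<theta>")
  case True
  obtain \<xi> where \<xi>: "p * \<theta> < \<xi>" "\<xi> < q * \<theta>" "cos (q * \<theta>) - cos (p * \<theta>) = (q * \<theta> - p * \<theta>) * - sin \<xi>"
    using MVT2[OF True, of cos "\<lambda>x. - sin x"] by auto
  have p0: "0 \<le> p * \<theta>" and qr: "q * \<theta> \<le> r * \<theta>" using assms by (auto intro: mult_right_mono)
  have "0 \<le> sin \<xi>" using \<xi> p0 qr assms pi_gt_zero by (intro sin_ge_zero) linarith+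
  moreover have "sin \<xi> \<le> sin (r * \<theta>)"
    using \<xi> p0 qr assms pi_gt_zero by (intro sin_monotone_2pi_le) linarith+
  ultimately have "\<bar>(q * \<theta> - p * \<theta>) * - sin \<xi>\<bar> \<le> (q * \<theta> - p * \<theta>) * sin (r * \<theta>)"
    using True by (simp add: abs_mult)
  then show ?thesis using \<xi>(3) by (simp add: abs_minus_commute algebra_simps)
next
  case False
  then have "p * \<theta> = q * \<theta>" using assms mult_right_mono[of p q \<theta>] by simp
  then have "\<bar>cos (p * \<theta>) - cos (q * \<theta>)\<bar> = 0" by (simp only: diff_self abs_zero)
  moreover have "0 \<le> sin (r * \<theta>)" using assms pi_gt_zero by (intro sin_ge_zero mult_nonneg_nonneg) linarith+
  then have "0 \<le> (q - p) * (\<theta> * sin (r * \<theta>))" using assms by simp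
  ultimately show ?thesis by linarith
qed

text \<open>The reflection \<open>i\<close> to \<open>K - i\<close> exchanges sine and cosine, so
  twice the sum counts the \<open>K + 1\<close> indices.\<close>

lemma sum_sin_squared:
  assumes "real K * \<phi> = pi / 2"
  shows "(\<Sum>i<K. (sin (real (Suc i) * \<phi>))\<^sup>2) = (real K + 1) / 2"
proof -
  have "(\<Sum>i\<le>K. (sin (real i * \<phi>))\<^sup>2) = (\<Sum>i\<le>K. (sin (real (K - i) * \<phi>))\<^sup>2)"
    by (rule sum.reindex_bij_witness[of _ "\<lambda>i. K - i" "\<lambda>i. K - i"]) auto
  also have "\<dots> = (\<Sum>i\<le>K. (cos (real i * \<phi>))\<^sup>2)"
    by (intro sum.cong refl) (simp add: left_diff_distrib assms cos_sin_eq)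
  also have "\<dots> = (\<Sum>i\<le>K. 1 - (sin (real i * \<phi>))\<^sup>2)" by (simp add: cos_squared_eq)
  finally have "(\<Sum>i\<le>K. (sin (real i * \<phi>))\<^sup>2) = (real K + 1) / 2" by (simp add: sum_subtractf)
  moreover have "(\<Sum>i\<le>K. (sin (real i * \<phi>))\<^sup>2) = (\<Sum>i<K. (sin (real (Suc i) * \<phi>))\<^sup>2)"
    by (subst sum.atMost_shift) simp
  ultimately show ?thesis by simp
qed

lemma mult_half_pi_fraction: "0 < m \<Longrightarrow> real m * (pi / (2 * real m)) = pi / 2"
  by (simp add: field_simps)

context chain
begin

text \<open>
  Bridges have length \<^term>\<open>a\<close> and the edges at the two end vertices of a block length 1, in proportion
  to the potential drops of a unit flow along the chain.
\<close>

definition position :: "nat \<Rightarrow> nat" where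
  "position t = (if t < a + 3 then 0 else
     ((t - (a + 3)) div (a + 2)) * (a + 2) + a +
     (if (t - (a + 3)) mod (a + 2) = 0 then 0 else if (t - (a + 3)) mod (a + 2) = a + 1 then 2 else 1))"

lemma position_head: "t < a + 3 \<Longrightarrow> position t = 0" by (simp add: position_def)

lemma position_block:
  assumes "k < a + 2"
  shows "position (block_start i + k) = i * (a + 2) + a + (if k = 0 then 0 else if k = a + 1 then 2 else 1)"
proof -
  have "block_start i + k - (a + 3) = i * (a + 2) + k" by (simp add: block_start_def)
  moreover have "(i * (a + 2) + k) div (a + 2) = i" "(i * (a + 2) + k) mod (a + 2) = k"
    using div_mult_self3[of "a + 2" i k] mod_mult_self3[of i "a + 2" k] assms by (simp_all only: div_less mod_less)
  ultimately show ?thesis using block_start_ge[of i] unfolding position_def by (simp only:) auto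
qed

lemma position_pred: "position (block_start i - 1) = i * (a + 2)"
proof (cases i)
  case 0
  then show ?thesis by (simp add: position_head block_start_def)
next
  case (Suc j)
  then have "block_start i - 1 = block_start j + (a + 1)" by (simp add: block_start_Suc)
  then show ?thesis using position_block[of "a + 1" j] Suc by simp
qed

lemma position_block_le:
  "k < a + 2 \<Longrightarrow> position (block_start i + k) \<le> Suc i * (a + 2)"
  by (simp add: position_block)

lemma forward_set:
  assumes "k < a + 2"
  shows "{s. chain_forward a s (block_start i + k)} = 
    (if k = 0 then {block_start i - 1} else if k = a + 1 then {block_start i + 1..<block_start i + (a + 1)}
     else {block_start i..<block_start i + k})"
  unfolding forward_to_block[OF assms] using block_start_ge[of i] a_ge assms by auto

lemma position_forward:
  assumes k: "k < a + 2" and s: "chain_forward a s (block_start i + k)"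
  shows "position s \<le> position (block_start i + k)"
    and "position (block_start i + k) - position s = 
      (if k = 0 then a else if k = a + 1 \<or> s = block_start i then 1 else 0)"
proof -
  have "s \<in> {s. chain_forward a s (block_start i + k)}" using s by simp
  then have *: "if k = 0 then s = block_start i - 1
      else if k = a + 1 then block_start i + 1 \<le> s \<and> s < block_start i + (a + 1)
      else block_start i \<le> s \<and> s < block_start i + k"
    unfolding forward_set[OF k] by (simp split: if_splits)
  consider "k = 0" "s = block_start i - 1" | j where "k = a + 1" "s = block_start i + j" "1 \<le> j" "j \<le> a"
    | "0 < k" "k \<le> a" "s = block_start i" | j where "k \<le> a" "s = block_start i + j" "1 \<le> j" "j < k"
  proof -
    consider "k = 0" | "k = a + 1" | "0 < k" "k \<le> a" "s = block_start i" | "0 < k" "k \<le> a" "s \<noteq> block_start i"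
      using k by linarith
    then show thesis
    proof cases
      case 1 then show ?thesis using that(1) * by simp
    next
      case 2 then show ?thesis using that(2)[of "s - block_start i"] * by auto
    next
      case 3 then show ?thesis using that(3) by simp
    next
      case 4 then show ?thesis using that(4)[of "s - block_start i"] * by auto
    qed
  qed
  then have "position s \<le> position (block_start i + k) \<and> position (block_start i + k) - position s = 
      (if k = 0 then a else if k = a + 1 \<or> s = block_start i then 1 else 0)"
  proof cases
    case 1
    then show ?thesis using position_pred[of i] position_block[of 0 i] by simp
  next
    case (2 j)
    then show ?thesis using position_block[of j i] position_block[OF k, of i] by simp
  next
    case 3
    then show ?thesis using position_block[of 0 i] position_block[OF k, of i] by simp
  next
    case (4 j)
    then show ?thesis using position_block[of j i] position_block[OF k, of i] by simp
  qed
  then show "position s \<le> position (block_start i + k)"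
    and "position (block_start i + k) - position s = 
      (if k = 0 then a else if k = a + 1 \<or> s = block_start i then 1 else 0)" by auto
qed

definition step_energy :: "nat \<Rightarrow> real" where
  "step_energy k = (if k = 0 then a\<^sup>2 else if k = a + 1 then a else 1)"

lemma step_energy_eq:
  assumes k: "k < a + 2"
  shows "(\<Sum>s | chain_forward a s (block_start i + k). (real (position (block_start i + k)) - real (position s))\<^sup>2) = step_energy k"
proof -
  have "(\<Sum>s | chain_forward a s (block_start i + k). (real (position (block_start i + k)) - real (position s))\<^sup>2)
      = (\<Sum>s | chain_forward a s (block_start i + k). (real (if k = 0 then a else if k = a + 1 \<or> s = block_start i then 1 else 0))\<^sup>2)"
    by (intro sum.cong refl) (simp add: position_forward[OF k] flip: of_nat_diff)
  also have "\<dots> = step_energy k"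
  proof -
    consider "k = 0" | "k = a + 1" | "0 < k" "k \<le> a" using k by linarith
    then show ?thesis
    proof cases
      case 3
      then have "(\<Sum>s = block_start i..<block_start i + k. (real (if k = 0 then a else if k = a + 1 \<or> s = block_start i then 1 else 0))\<^sup>2)
          = (\<Sum>s\<in>{block_start i}. 1)"
        by (intro sum.mono_neutral_cong_right) auto
      then show ?thesis using 3 by (simp add: forward_set[OF k] step_energy_def)
    next
      case 1
      then show ?thesis unfolding forward_set[OF k] step_energy_def by simp
    next
      case 2
      then show ?thesis unfolding forward_set[OF k] step_energy_def by simp
    qed
  qed
  finally show ?thesis .
qed

text \<open>The bridge contributes \<open>a\<^sup>2\<close> and the edges at either end vertex
  contribute \<open>a\<close>. Energy \<open>a * (a + 2)\<close> on \<open>a + 2\<close> vertices,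
  at total length \<open>a + 2\<close>, produces the factor \<open>a\<close> of the limit.\<close>

lemma sum_step_energy: "(\<Sum>k<a + 2. step_energy k) = a * (a + 2)"
proof -
  have "(\<Sum>k<a + 2. step_energy k) = (\<Sum>k<a. step_energy (Suc k)) + step_energy 0 + step_energy (a + 1)"
    using sum.lessThan_Suc_shift[of step_energy "Suc a"] by (simp del: sum.lessThan_Suc) simp
  also have "(\<Sum>k<a. step_energy (Suc k)) = (\<Sum>k<a. 1)" by (intro sum.cong) (auto simp: step_energy_def)
  finally show ?thesis by (simp add: step_energy_def power2_eq_square algebra_simps)
qed

lemma sum_blocks: "(\<Sum>t=block_start 0..<block_start K. g t) = (\<Sum>i<K. \<Sum>k<a + 2. g (block_start i + k))"
  for g :: "nat \<Rightarrow> real"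
proof (induction K)
  case (Suc K)
  have "(\<Sum>t=block_start 0..<block_start (Suc K). g t)
      = (\<Sum>t=block_start 0..<block_start K. g t) + (\<Sum>t=block_start K..<block_start K + (a + 2). g t)"
    unfolding block_start_Suc by (rule sum.atLeastLessThan_concat[symmetric]) (auto simp: block_start_def)
  also have "(\<Sum>t=block_start K..<block_start K + (a + 2). g t) = (\<Sum>k<a + 2. g (block_start K + k))"
    using sum.shift_bounds_nat_ivl[of g 0 "block_start K" "a + 2"] by (simp add: lessThan_atLeast0 add.commute)
  finally show ?case using Suc by simp
qed simp


section \<open>The truncated cosine as a test vector\<close>

definition test_vector :: "nat \<Rightarrow> nat \<Rightarrow> real" where
  "test_vector K t = cos (real (min (position t) (K * (a + 2))) * (pi / (2 * real (K * (a + 2)))))"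

lemma test_vector_head: "t < a + 3 \<Longrightarrow> test_vector K t = 1"
  by (simp add: test_vector_def position_head)

text \<open>From the last vertex of block \<open>K - 1\<close> on, the position has reached the cap
  \<open>K * (a + 2)\<close>, where the angle is a right angle.\<close>

lemma test_vector_zero:
  assumes "0 < K" "block_start K - 1 \<le> t"
  shows "test_vector K t = 0"
proof -
  have "K * (a + 2) \<le> position t"
  proof (cases "t = block_start K - 1")
    case True
    then show ?thesis by (simp only: position_pred order_refl)
  next
    case False
    then have t: "block_start K \<le> t" "a + 3 \<le> t" using assms block_start_ge[of K] by auto
    obtain i k where ik: "t = block_start i + k" "k < a + 2" using t(2) by (rule block_cases)
    have "K \<le> i"
    proof (rule ccontr)
      assume "\<not> K \<le> i"
      then have "Suc i * (a + 2) \<le> K * (a + 2)" by (intro mult_right_mono) auto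
      then show False using ik t by (simp add: block_start_def)
    qed
    then have "K * (a + 2) \<le> i * (a + 2)" by (intro mult_right_mono) auto
    then show ?thesis using position_block[OF ik(2), of i] ik(1) by simp
  qed
  moreover have "real (K * (a + 2)) * (pi / (2 * real (K * (a + 2)))) = pi / 2"
    using assms(1) by (intro mult_half_pi_fraction) simp
  ultimately show ?thesis unfolding test_vector_def by (simp only: min_absorb2 cos_pi_half)
qed

text \<open>Only the vertex \<open>block_start K - 1\<close> has a bridge out of the first
  \<open>K\<close> blocks, and the test vector vanishes there. Vertices of the support therefore
  keep full degree in the finite graph.\<close>

lemma neighbours_of_support:
  assumes K: "0 < K" and s: "s < block_start K - 1" and adj: "chain_adj a s t"
  shows "t < block_start K"
proof (rule ccontr)
  assume t: "\<not> t < block_start K"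
  then have "s < t" using s by linarith
  then have "\<not> chain_forward a t s" by (simp add: chain_forward_def)
  then have f: "chain_forward a s t" using adj by (simp add: chain_adj_def)
  have "a + 3 \<le> t" using t block_start_ge[of K] by linarith
  then obtain i k where ik: "t = block_start i + k" "k < a + 2" by (rule block_cases)
  have "K \<le> i"
  proof (rule ccontr)
    assume "\<not> K \<le> i"
    then have "Suc i * (a + 2) \<le> K * (a + 2)" by (intro mult_right_mono) auto
    then show False using ik t by (simp add: block_start_def)
  qed
  then have "K * (a + 2) \<le> i * (a + 2)" by (intro mult_right_mono) auto
  then have "block_start K \<le> block_start i" by (simp add: block_start_def)
  then show False using f[unfolded ik(1) forward_to_block[OF ik(2)]] s ik(1) by linarith
qed

text \<open>Within a block the slope of the cosine is bounded by its value at the end of the block;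
  dually, \<open>test_vector_mass\<close> bounds the cosine from below there. Both sums then
  separate into blocks.\<close>

lemma test_vector_step:
  assumes i: "i < K" and k: "k < a + 2" and s: "chain_forward a s (block_start i + k)"
  defines "\<theta> \<equiv> pi / (2 * real (K * (a + 2)))"
  shows "(test_vector K s - test_vector K (block_start i + k))\<^sup>2 \<le>
    (\<theta> * sin (real (Suc i * (a + 2)) * \<theta>))\<^sup>2 * (real (position (block_start i + k)) - real (position s))\<^sup>2"
proof -
  let ?t = "block_start i + k"
  have le: "Suc i * (a + 2) \<le> K * (a + 2)" using i by (intro mult_right_mono) auto
  have p: "position s \<le> position ?t" "position ?t \<le> Suc i * (a + 2)"
    using position_forward(1)[OF k s] position_block_le[OF k] by auto
  then have m: "min (position s) (K * (a + 2)) = position s" "min (position ?t) (K * (a + 2)) = position ?t"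
    using le by (meson min_absorb1 order_trans)+
  have \<theta>: "0 \<le> \<theta>" by (simp add: \<theta>_def)
  have "real (Suc i * (a + 2)) * \<theta> \<le> real (K * (a + 2)) * \<theta>"
    using le \<theta> by (intro mult_right_mono[OF of_nat_mono])
  also have "\<dots> = pi / 2" unfolding \<theta>_def using i by (intro mult_half_pi_fraction) simp
  finally have "\<bar>cos (position s * \<theta>) - cos (position ?t * \<theta>)\<bar>
      \<le> (real (position ?t) - real (position s)) * (\<theta> * sin (real (Suc i * (a + 2)) * \<theta>))"
    using p \<theta> by (rule_tac cos_increment_bound) (simp_all only: of_nat_le_iff of_nat_0_le_iff)
  then have "\<bar>test_vector K s - test_vector K ?t\<bar> \<le> (real (position ?t) - real (position s)) * (\<theta> * sin (real (Suc i * (a + 2)) * \<theta>))"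
    unfolding test_vector_def m \<theta>_def .
  from power_mono[OF this abs_ge_zero, of 2] show ?thesis
    by (simp only: power2_abs power_mult_distrib mult.commute)
qed

lemma test_vector_mass:
  assumes i: "i < K" and k: "k < a + 2"
  defines "\<theta> \<equiv> pi / (2 * real (K * (a + 2)))"
  shows "(cos (real (Suc i * (a + 2)) * \<theta>))\<^sup>2 \<le> (test_vector K (block_start i + k))\<^sup>2"
proof -
  have le: "Suc i * (a + 2) \<le> K * (a + 2)" using i by (intro mult_right_mono) auto
  have p: "position (block_start i + k) \<le> Suc i * (a + 2)" using position_block_le[OF k] by auto
  have m: "min (position (block_start i + k)) (K * (a + 2)) = position (block_start i + k)"
    using p le by (meson min_absorb1 order_trans)
  have \<theta>: "0 \<le> \<theta>" by (simp add: \<theta>_def)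
  have "real (Suc i * (a + 2)) * \<theta> \<le> real (K * (a + 2)) * \<theta>"
    using le \<theta> by (intro mult_right_mono[OF of_nat_mono])
  also have "\<dots> = pi / 2" unfolding \<theta>_def using i by (intro mult_half_pi_fraction) simp
  finally have 1: "real (Suc i * (a + 2)) * \<theta> \<le> pi / 2" .
  have 2: "real (position (block_start i + k)) * \<theta> \<le> real (Suc i * (a + 2)) * \<theta>"
    using p \<theta> by (intro mult_right_mono[OF of_nat_mono])
  have 0: "0 \<le> real (Suc i * (a + 2)) * \<theta>" using \<theta> by simp
  have "cos (real (Suc i * (a + 2)) * \<theta>) \<le> cos (real (position (block_start i + k)) * \<theta>)"
    using 1 2 pi_gt_zero mult_nonneg_nonneg[OF of_nat_0_le_iff \<theta>, of "position (block_start i + k)"]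
    by (intro cos_monotone_0_pi_le) linarith+
  moreover have "0 \<le> cos (real (Suc i * (a + 2)) * \<theta>)"
    using 0 1 by (intro cos_ge_zero) linarith+
  ultimately show ?thesis unfolding test_vector_def m \<theta>_def by (intro power_mono)
qed

lemma chain_spectral_radius:
  assumes K: "2 \<le> K" and n: "block_start K \<le> n"
  shows "real (a + 1) - a * (pi / (2 * real (K * (a + 2))))\<^sup>2 * (real K + 1) / (real K - 1)
    \<le> graph_spectral_radius (chain_graph a n)"
proof -
  let ?x = "test_vector K" and ?\<rho> = "graph_spectral_radius (chain_graph a n)"
  define B where "B s t = (if chain_adj a s t then 1 else 0 :: real)" for s t
  define \<theta> where "\<theta> = pi / (2 * real (K * (a + 2)))"
  define M where "M = (\<Sum>s<n. (?x s)\<^sup>2)"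
  define E where "E = (\<Sum>t<n. \<Sum>s<t. B s t * (?x s - ?x t)\<^sup>2)"
  have K0: "0 < K" using K by simp
  have sym: "B s t = B t s" for s t using adj_sym by (simp add: B_def)
  have deg: "(\<Sum>t<n. B s t) = real (a + 1)" if "s < n" "?x s \<noteq> 0" for s
  proof -
    have "s < block_start K - 1" using test_vector_zero[OF K0, of s] that by force
    then have "{t. chain_adj a s t} \<subseteq> {..<n}" using neighbours_of_support[OF K0] n by fastforce
    then have "(\<Sum>t<n. B s t) = (\<Sum>t | chain_adj a s t. 1)"
      by (intro sum.mono_neutral_cong_right) (auto simp: B_def)
    then show ?thesis using neighbours_card[of s] by simp
  qed
  have "adjacency_matrix (chain_graph a n) = mat n n (\<lambda>(i, j). complex_of_real (B i j))"
    by (rule eq_matI) (auto simp: adjacency_matrix_def chain_graph_def B_def)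
  then have "(\<Sum>s<n. \<Sum>t<n. B s t * ?x s * ?x t) \<le> ?\<rho> * M"
    using quadratic_form_le_spectral_radius[of B ?x n, OF sym] by (simp add: graph_spectral_radius_def M_def)
  moreover have "real (a + 1) * M - (\<Sum>s<n. \<Sum>t<n. B s t * ?x s * ?x t) = E"
    unfolding M_def E_def by (rule dirichlet_form) (use sym deg in auto)
  ultimately have main: "(real (a + 1) - ?\<rho>) * M \<le> E" by (simp add: left_diff_distrib)
  have B_fwd: "(\<Sum>s<t. B s t * f s) = (\<Sum>s | chain_forward a s t. f s)" for f t
    by (rule sum.mono_neutral_cong_right) (auto simp: B_def chain_adj_def chain_forward_def)
  let ?\<phi> = "real (a + 2) * \<theta>"
  have "real (K * (a + 2)) * \<theta> = pi / 2" unfolding \<theta>_def using K by (intro mult_half_pi_fraction) simp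
  then have K\<phi>: "real K * ?\<phi> = pi / 2" by (simp only: of_nat_mult mult.assoc)
  have ang: "real (Suc i * (a + 2)) * \<theta> = real (Suc i) * ?\<phi>" for i by (simp only: of_nat_mult mult.assoc)
  let ?g = "\<lambda>t. \<Sum>s<t. B s t * (?x s - ?x t)\<^sup>2"
  have split: "{..<n} = {..<block_start 0} \<union> {block_start 0..<block_start K} \<union> {block_start K..<n}"
    using n by (auto simp: block_start_def)
  have head: "?g t = 0" if "t < block_start 0" for t
    using that by (intro sum.neutral) (auto simp: test_vector_head block_start_def)
  have tail: "?g t = 0" if t: "block_start K \<le> t" for t
    unfolding B_fwd
  proof (rule sum.neutral, rule ballI)
    fix s assume "s \<in> {s. chain_forward a s t}"
    then have "block_start K - 1 \<le> s"
      using neighbours_of_support[OF K0, of s t] t by (force simp: chain_adj_def)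
    then show "(?x s - ?x t)\<^sup>2 = 0" using test_vector_zero[OF K0] t by simp
  qed
  have "E = (\<Sum>t=block_start 0..<block_start K. ?g t)"
    unfolding E_def split using head tail
    by (intro sum.mono_neutral_right) auto
  also have "\<dots> = (\<Sum>i<K. \<Sum>k<a + 2. ?g (block_start i + k))" by (rule sum_blocks)
  also have "\<dots> \<le> (\<Sum>i<K. \<Sum>k<a + 2. (\<theta> * sin (real (Suc i) * ?\<phi>))\<^sup>2 * step_energy k)"
  proof (intro sum_mono)
    fix i k assume ik: "i \<in> {..<K}" "k \<in> {..<a + 2}"
    let ?t = "block_start i + k"
    have "?g ?t \<le> (\<Sum>s | chain_forward a s ?t. (\<theta> * sin (real (Suc i) * ?\<phi>))\<^sup>2 * (real (position ?t) - real (position s))\<^sup>2)"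
      unfolding B_fwd ang[symmetric] using ik
      by (intro sum_mono test_vector_step[of i K k, folded \<theta>_def]) auto
    also have "\<dots> = (\<theta> * sin (real (Suc i) * ?\<phi>))\<^sup>2 * step_energy k"
      using step_energy_eq[of k i] ik by (simp flip: sum_distrib_left)
    finally show "?g ?t \<le> (\<theta> * sin (real (Suc i) * ?\<phi>))\<^sup>2 * step_energy k" .
  qed
  also have "\<dots> = (\<Sum>i<K. (\<theta> * sin (real (Suc i) * ?\<phi>))\<^sup>2 * real (a * (a + 2)))"
    unfolding sum_distrib_left[symmetric] sum_step_energy ..
  also have "\<dots> = \<theta>\<^sup>2 * real (a * (a + 2)) * (\<Sum>i<K. (sin (real (Suc i) * ?\<phi>))\<^sup>2)"
    by (simp only: sum_distrib_left power_mult_distrib mult_ac)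
  also have "\<dots> = \<theta>\<^sup>2 * real (a * (a + 2)) * ((real K + 1) / 2)"
    unfolding sum_sin_squared[OF K\<phi>] ..
  finally have E: "E \<le> \<theta>\<^sup>2 * real (a * (a + 2)) * ((real K + 1) / 2)" .
  have "(\<Sum>i<K. (cos (real (Suc i) * ?\<phi>))\<^sup>2) = (\<Sum>i<K. 1 - (sin (real (Suc i) * ?\<phi>))\<^sup>2)"
    by (simp only: cos_squared_eq)
  also have "\<dots> = (real K - 1) / 2"
    unfolding sum_subtractf sum_sin_squared[OF K\<phi>] by (simp add: field_simps)
  finally have "real (a + 2) * ((real K - 1) / 2) = (\<Sum>i<K. \<Sum>k<a + 2. (cos (real (Suc i) * ?\<phi>))\<^sup>2)"
    by (simp flip: sum_distrib_left)
  also have "\<dots> \<le> (\<Sum>i<K. \<Sum>k<a + 2. (?x (block_start i + k))\<^sup>2)"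
    unfolding ang[symmetric] by (intro sum_mono test_vector_mass[of _ K, folded \<theta>_def]) auto
  also have "\<dots> = (\<Sum>t=block_start 0..<block_start K. (?x t)\<^sup>2)" by (rule sum_blocks[symmetric])
  also have "\<dots> \<le> M" unfolding M_def using n by (intro sum_mono2) auto
  finally have M: "real (a + 2) * ((real K - 1) / 2) \<le> M" .
  show ?thesis
  \<comment> \<open>The lower bound for \<open>M\<close> can be multiplied by
    \<open>real (a + 1) - ?\<rho>\<close> only if this is nonnegative; otherwise the claim is
    immediate.\<close>
  proof (cases "real (a + 1) \<le> ?\<rho>")
    case True
    moreover have "0 \<le> a * \<theta>\<^sup>2 * (real K + 1) / (real K - 1)" using K by simp
    ultimately show ?thesis unfolding \<theta>_def by linarith
  next
    case False
    then have "(real (a + 1) - ?\<rho>) * (real (a + 2) * ((real K - 1) / 2)) \<le> (real (a + 1) - ?\<rho>) * M"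
      using M by (intro mult_left_mono) auto
    also note main
    also note E
    finally have "real (a + 2) * ((real (a + 1) - ?\<rho>) * (real K - 1)) \<le> real (a + 2) * (a * \<theta>\<^sup>2 * (real K + 1))"
      by (simp add: field_simps)
    then have "(real (a + 1) - ?\<rho>) * (real K - 1) \<le> a * \<theta>\<^sup>2 * (real K + 1)"
      by (subst (asm) mult_le_cancel_left_pos) auto
    then have "real (a + 1) - ?\<rho> \<le> a * \<theta>\<^sup>2 * (real K + 1) / (real K - 1)"
      using K by (simp add: pos_le_divide_eq)
    then show ?thesis unfolding \<theta>_def by linarith
  qed
qed

end

subsection \<open>The limit\<close>

lemma lower_comparison_limit:
  "(\<lambda>n. (real n)\<^sup>2 * (4 * (sin (pi / (4 * (real n + c))))\<^sup>2)) \<longlonglongrightarrow> pi\<^sup>2 / 4"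
  by (real_asymp simp: power2_eq_square)

lemma upper_comparison_limit:
  fixes c d :: real assumes "0 < d"
  shows "(\<lambda>n. (real n)\<^sup>2 * (pi / (2 * (real n - c)))\<^sup>2 * (((real n - c) / d + 1) / ((real n - c) / d - 1))) \<longlonglongrightarrow> pi\<^sup>2 / 4"
  using assms by (real_asymp simp: power2_eq_square)

theorem theorem1:
  fixes \<Delta> :: nat
  assumes "odd \<Delta>" and "\<Delta> \<ge> 5"
  shows "(\<lambda>n. (real n)\<^sup>2 * (real \<Delta> - lambda1 n \<Delta>) / (real \<Delta> - 1)) \<longlonglongrightarrow> pi\<^sup>2 / 4"
proof -
  define a where "a = \<Delta> - 1"
  have a: "\<Delta> = a + 1" "4 \<le> a" "even a" using assms by (auto simp: a_def)
  interpret chain a by unfold_locales (use a in auto)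
  define c where "c = real (4 * (a + 1) * (a + 4))"
  \<comment> \<open>Large enough for \<open>(n - e) / d > 2\<close>, hence for at least two full
    blocks.\<close>
  define N where "N = 4 * a + 10"
  have c: "real (n + 4 * (a + 1) * (a + 4)) = real n + c" for n by (simp add: c_def)
  have mem: "chain_graph a n \<in> nonregular_family n \<Delta>" if "N \<le> n" for n
    using chain_graph_mem[of n] that a(1) by (simp add: N_def)
  have fin: "finite (graph_spectral_radius ` nonregular_family n \<Delta>)" for n
    using finite_nonregular_family by simp
  have lower: "(real n)\<^sup>2 * (4 * (sin (pi / (4 * (real n + c))))\<^sup>2) \<le> (real n)\<^sup>2 * (real \<Delta> - lambda1 n \<Delta>) / a"
    if n: "N \<le> n" for n
  proof -
    have "lambda1 n \<Delta> \<in> graph_spectral_radius ` nonregular_family n \<Delta>"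
      unfolding lambda1_def using mem[OF n] by (intro Max_in fin) auto
    then obtain G where G: "G \<in> nonregular_family n \<Delta>" "lambda1 n \<Delta> = graph_spectral_radius G" by auto
    interpret nonregular_member G n \<Delta> by unfold_locales (fact G(1))
    have "a * (4 * (sin (pi / (4 * (real n + c))))\<^sup>2) \<le> real \<Delta> - lambda1 n \<Delta>"
      using spectral_radius_upper_bound[OF a(1)] a(2) G(2) unfolding c by simp
    then have "(real n)\<^sup>2 * (a * (4 * (sin (pi / (4 * (real n + c))))\<^sup>2)) \<le> (real n)\<^sup>2 * (real \<Delta> - lambda1 n \<Delta>)"
      by (intro mult_left_mono) auto
    then show ?thesis using a(2) by (simp add: field_simps)
  qed
  \<comment> \<open>The head, of \<open>a + 3\<close> vertices, plus at most one incomplete block,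
    so that \<open>n - e \<le> K * d\<close> for the number \<open>K\<close> of full blocks.\<close>
  define e where "e = real (2 * a + 5)"
  define d where "d = real (a + 2)"
  have upper: "(real n)\<^sup>2 * (real \<Delta> - lambda1 n \<Delta>) / a
      \<le> (real n)\<^sup>2 * (pi / (2 * (real n - e)))\<^sup>2 * (((real n - e) / d + 1) / ((real n - e) / d - 1))"
    if n: "N \<le> n" for n
  proof -
    define K where "K = (n - (a + 3)) div (a + 2)"
    have T: "K * (a + 2) \<le> n - (a + 3)" "n - (a + 3) < K * (a + 2) + (a + 2)"
      using div_times_less_eq_dividend[of "n - (a + 3)" "a + 2"] dividend_less_div_times[of "a + 2" "n - (a + 3)"]
      by (auto simp: K_def)
    have n_nat: "n < K * (a + 2) + (2 * a + 5)" using T(2) n by (simp add: N_def)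
    have "real n < real (K * (a + 2) + (2 * a + 5))" using n_nat by (simp only: of_nat_less_iff)
    then have ne: "real n - e \<le> K * d" by (simp add: e_def d_def algebra_simps)
    have d0: "0 < d" by (simp add: d_def)
    have "real (4 * a + 10) \<le> real n" using n by (simp only: N_def of_nat_le_iff)
    then have "2 * d < real n - e" by (simp add: d_def e_def)
    then have ned: "2 < (real n - e) / d" using d0 by (simp add: field_simps)
    have pos: "0 < real n - e" using \<open>2 * d < real n - e\<close> d0 by linarith
    have Kd: "(real n - e) / d \<le> K" using ne d0 by (simp add: field_simps)
    then have K: "2 \<le> K" using ned by linarith
    have "block_start K \<le> n" unfolding block_start_def using T(1) n by (simp add: N_def)
    then have "real (a + 1) - a * (pi / (2 * real (K * (a + 2))))\<^sup>2 * (real K + 1) / (real K - 1)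
        \<le> graph_spectral_radius (chain_graph a n)"
      by (rule chain_spectral_radius[OF K])
    also have "\<dots> \<le> lambda1 n \<Delta>" unfolding lambda1_def using mem[OF n] by (intro Max_ge fin) auto
    finally have "real \<Delta> - lambda1 n \<Delta> \<le> a * ((pi / (2 * real (K * (a + 2))))\<^sup>2 * ((real K + 1) / (real K - 1)))"
      using a(1) by (simp add: mult.assoc)
    also have "\<dots> \<le> a * ((pi / (2 * (real n - e)))\<^sup>2 * (((real n - e) / d + 1) / ((real n - e) / d - 1)))"
    proof (intro mult_left_mono mult_mono power_mono)
      show "pi / (2 * real (K * (a + 2))) \<le> pi / (2 * (real n - e))"
      proof -
        have "real (K * (a + 2)) = K * d" by (simp only: d_def of_nat_mult)
        then show ?thesis using ne pos d0 K by (intro divide_left_mono) auto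
      qed
      have ratio: "(r + 1) / (r - 1) = 1 + 2 / (r - 1)" if "2 \<le> r" for r :: real
        using that by (simp add: field_simps)
      have "(real K + 1) / (real K - 1) = 1 + 2 / (real K - 1)" using K by (intro ratio) simp
      also have "\<dots> \<le> 1 + 2 / ((real n - e) / d - 1)"
        using Kd ned by (intro add_left_mono divide_left_mono) (auto intro!: mult_pos_pos)
      also have "\<dots> = ((real n - e) / d + 1) / ((real n - e) / d - 1)"
        using ned by (intro ratio[symmetric]) simp
      finally show "(real K + 1) / (real K - 1) \<le> ((real n - e) / d + 1) / ((real n - e) / d - 1)" .
    qed (use K ned in auto)
    finally have "(real n)\<^sup>2 * (real \<Delta> - lambda1 n \<Delta>) / a \<le> (real n)\<^sup>2 * (a * ((pi / (2 * (real n - e)))\<^sup>2 * (((real n - e) / d + 1) / ((real n - e) / d - 1)))) / a"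
      by (intro divide_right_mono mult_left_mono) auto
    also have "\<dots> = (real n)\<^sup>2 * (pi / (2 * (real n - e)))\<^sup>2 * (((real n - e) / d + 1) / ((real n - e) / d - 1))"
      using a(2) by simp
    finally show ?thesis .
  qed
  have "(\<lambda>n. (real n)\<^sup>2 * (real \<Delta> - lambda1 n \<Delta>) / a) \<longlonglongrightarrow> pi\<^sup>2 / 4"
  proof (rule tendsto_sandwich)
    show "\<forall>\<^sub>F n in sequentially. (real n)\<^sup>2 * (4 * (sin (pi / (4 * (real n + c))))\<^sup>2) \<le> (real n)\<^sup>2 * (real \<Delta> - lambda1 n \<Delta>) / a"
      using lower eventually_sequentially by blast
    show "\<forall>\<^sub>F n in sequentially. (real n)\<^sup>2 * (real \<Delta> - lambda1 n \<Delta>) / a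
      \<le> (real n)\<^sup>2 * (pi / (2 * (real n - e)))\<^sup>2 * (((real n - e) / d + 1) / ((real n - e) / d - 1))"
      using upper eventually_sequentially by blast
  qed (rule lower_comparison_limit, rule upper_comparison_limit, simp add: d_def)
  then show ?thesis using a(1) by simp
qed

end
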